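(* Let $\mathcal{X}$ be a Polish space with Borel $\sigma$-algebra $\mathcal{B}$, let $n\ge 1$ and $\lambda=(\lambda_1,\ldots,\lambda_n)\in\Lambda^n$, and let $P_n$ be the distribution of a $\lambda$-exchangeable sequence $(X_1,\ldots,X_n)$ on $\mathcal{X}$. Let $1\le k\le n$ and let $P_k$ be the marginal distribution of $(X_1,\ldots,X_k)$. Assume that $$r_i:=\frac{\inf_{x\in\mathcal{X}}\lambda_i(x)}{\sup_{x\in\mathcal{X}}\lambda_i(x)}>0\quad\text{for all } i\in\{1,\ldots,n\}.$$ Then there exists a mixture of weighted i.i.d. distributions $Q_n$ on $\mathcal{X}^n$ (with respect to the weights $\lambda$), with $Q_{n,k}$ denoting its marginal distribution on the first $k$ coordinates, such that $$|P_k-Q_{n,k}|_{TV}\le \frac{k(k-1)}{2\min_{i\le k}r_i}\cdot\frac{1-e^{-\sum_{i=k+1}^n r_i}}{\sum_{i=k+1}^n r_i},$$ where for $k=n$ the last fraction is interpreted as $1$ (its limiting value as the sum tends to $0$).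
   Context: $\Lambda$ is the set of measurable functions $\mathcal{X}\to(0,\infty)$, and $\Lambda^n$ its $n$-fold product. $\mathcal{B}^n$ is the Borel $\sigma$-algebra of $\mathcal{X}^n$. A probability measure $P_n$ on $(\mathcal{X}^n,\mathcal{B}^n)$ (or a random sequence $(X_1,\ldots,X_n)$ with this distribution) is called $\lambda$-exchangeable, for $\lambda=(\lambda_1,\ldots,\lambda_n)\in\Lambda^n$, if the measure $\overline{P}_n$ defined by $\overline{P}_n(B)=\int_B \frac{dP_n(x_1,\ldots,x_n)}{\prod_{i=1}^n\lambda_i(x_i)}$, $B\in\mathcal{B}^n$, is an exchangeable probability measure (i.e. invariant under all permutations of the $n$ coordinates). For a probability measure $\mu$ on $\mathcal{X}$ and a bounded $\lambda_i\in\Lambda$, let $T_i\mu$ be the probability measure $T_i\mu(dx)=\lambda_i(x)\mu(dx)/\int\lambda_i\,d\mu$. A weighted i.i.d. distribution on $\mathcal{X}^n$ is a product measure $\otimes_{i=1}^n T_i\mu$ with $\mu$ a probability measure on $\mathcal{X}$. A mixture of weighted i.i.d. distributions on $\mathcal{X}^n$ is a measure of the form $\int_{\mathcal{P}(\mathcal{X})}\otimes_{i=1}^n T_i\mu\,\Pi(d\mu)$ with $\Pi$ a probability measure on the space $\mathcal{P}(\mathcal{X})$ of probability measures on $\mathcal{X}$ (with the Borel $\sigma$-algebra of the weak topology). The total variation distance is $|P-Q|_{TV}:=\sup_A|P(A)-Q(A)|$ over measurable sets $A$. *)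

theory Defs
  imports "HOL-Probability.Probability"
begin

text \<open>
  The space \<open>X^n\<close> is the space of functions on \<open>{1..n}\<close> (extensional, in the sense of
  \<^const>\<open>PiE\<close>) with the product \<open>\<sigma>\<close>-algebra. Polish spaces being second countable, this is
  the Borel \<open>\<sigma>\<close>-algebra of the product topology.
\<close>

abbreviation seq_space :: "nat \<Rightarrow> (nat \<Rightarrow> 'a::topological_space) measure" where
  "seq_space n \<equiv> Pi\<^sub>M {1..n} (\<lambda>_. borel)"

definition weights :: "('a::topological_space \<Rightarrow> real) set" where
  "weights = {l \<in> borel_measurable borel. \<forall>x. 0 < l x}"

definition exchangeable :: "nat \<Rightarrow> (nat \<Rightarrow> 'a::topological_space) measure \<Rightarrow> bool" where
  "exchangeable n P \<longleftrightarrow>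
     (\<forall>\<pi>. \<pi> permutes {1..n} \<longrightarrow>
        distr P (seq_space n) (\<lambda>x. \<lambda>i\<in>{1..n}. x (\<pi> i)) = P)"

definition weighted_exchangeable ::
    "nat \<Rightarrow> (nat \<Rightarrow> 'a::topological_space \<Rightarrow> real) \<Rightarrow> (nat \<Rightarrow> 'a) measure \<Rightarrow> bool" where
  "weighted_exchangeable n l P \<longleftrightarrow>
     prob_space P \<and> sets P = sets (seq_space n) \<and>
     (let P' = density P (\<lambda>x. ennreal (1 / (\<Prod>i\<in>{1..n}. l i (x i))))
      in prob_space P' \<and> exchangeable n P')"

definition marginal :: "nat \<Rightarrow> (nat \<Rightarrow> 'a::topological_space) measure \<Rightarrow> (nat \<Rightarrow> 'a) measure" where
  "marginal k P = distr P (seq_space k) (\<lambda>x. restrict x {1..k})"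

text \<open>
  Infimum and supremum are formed in \<^typ>\<open>ennreal\<close>, so that the ratio is \<open>0\<close> for an unbounded
  weight. For a positive weight the ratio is at most \<open>1\<close>, hence no information is lost
  by \<^const>\<open>enn2real\<close>.
\<close>

definition weight_ratio :: "('a \<Rightarrow> real) \<Rightarrow> real" where
  "weight_ratio l = enn2real ((INF x. ennreal (l x)) / (SUP x. ennreal (l x)))"

text \<open>The tilting \<open>T \<mu>\<close> of a probability measure; only used for bounded weights.\<close>

definition tilt :: "('a::topological_space \<Rightarrow> real) \<Rightarrow> 'a measure \<Rightarrow> 'a measure" where
  "tilt l \<mu> = density \<mu> (\<lambda>x. ennreal (l x / (\<integral>y. l y \<partial>\<mu>)))"

text \<open>
  The weak topology on the Borel probability measures is the coarsest one making
  \<open>\<mu> \<mapsto> \<integral> f d\<mu>\<close> continuous for all bounded continuous \<open>f\<close>. The \<open>\<sigma>\<close>-algebra used below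
  is generated by its open sets; of \<^const>\<open>prob_algebra\<close> only the carrier is used.
\<close>

definition weak_topology :: "'a::topological_space measure topology" where
  "weak_topology = topology_generated_by
     {{\<mu> \<in> space (prob_algebra borel). (\<integral>x. f x \<partial>\<mu>) \<in> U} | (f :: 'a \<Rightarrow> real) U.
        continuous_on UNIV f \<and> bounded (range f) \<and> open U}"

definition weak_borel :: "'a::topological_space measure measure" where
  "weak_borel = sigma (space (prob_algebra borel)) {U. openin weak_topology U}"

definition weighted_iid_mixture ::
    "nat \<Rightarrow> (nat \<Rightarrow> 'a::topological_space \<Rightarrow> real) \<Rightarrow> (nat \<Rightarrow> 'a) measure \<Rightarrow> bool" where
  "weighted_iid_mixture n l Q \<longleftrightarrow>
     sets Q = sets (seq_space n) \<and>
     (\<exists>\<nu>. prob_space \<nu> \<and> sets \<nu> = sets weak_borel \<and>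
        (\<forall>B \<in> sets (seq_space n).
           emeasure Q B = (\<integral>\<^sup>+\<mu>. emeasure (Pi\<^sub>M {1..n} (\<lambda>i. tilt (l i) \<mu>)) B \<partial>\<nu>)))"

definition tv_dist :: "'a measure \<Rightarrow> 'a measure \<Rightarrow> real" where
  "tv_dist P Q = (SUP A \<in> sets P. \<bar>measure P A - measure Q A\<bar>)"

end

theory Submission
  imports Defs
begin

text \<open>
  Write \<open>dP = \<Prod>\<^sub>i \<lambda>\<^sub>i(x\<^sub>i) dP'\<close> with \<open>P'\<close> exchangeable, and let \<open>c\<^sub>i\<close> and \<open>s\<^sub>i\<close> be the infimum
  and the supremum of \<open>\<lambda>\<^sub>i\<close>, so that \<open>r\<^sub>i = c\<^sub>i / s\<^sub>i\<close>.

  The weight of a coordinate \<open>i > k\<close> can be made constant at the price of a coin toss. Given \<open>x\<close>, keep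
  \<open>i\<close> with probability \<open>c\<^sub>i / \<lambda>\<^sub>i(x\<^sub>i)\<close>, independently for different \<open>i\<close>, and let \<open>J\<close> be the random
  set of kept indices. On the event that \<open>i\<close> is kept, the factor \<open>\<lambda>\<^sub>i(x\<^sub>i)\<close> of the density turns into
  the constant \<open>c\<^sub>i\<close>; otherwise it turns into \<open>\<lambda>\<^sub>i(x\<^sub>i) - c\<^sub>i\<close>. For fixed \<open>J\<close> the density
  is therefore \<open>\<Prod>\<^sub>i\<^sub>\<le>\<^sub>k \<lambda>\<^sub>i(x\<^sub>i)\<close> times a function of the coordinates outside the pool
  \<open>K = {1..k} \<union> J\<close>. Since \<open>P'\<close> is invariant under permutations of \<open>K\<close>, given the values found in the
  pool the first \<open>k\<close> coordinates are a weighted sample without replacement: an injection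
  \<open>f : {1..k} \<rightarrow> K\<close> has probability proportional to \<open>\<Prod>\<^sub>i \<lambda>\<^sub>i(x\<^bsub>f i\<^esub>)\<close>
  (\<open>integral_sample_without_replacement\<close>, \<open>integral_kept\<close>).

  Dropping injectivity from this description yields exactly \<open>\<Otimes>\<^sub>i T\<^sub>i \<mu>\<close> for the empirical
  measure \<open>\<mu>\<close> of the pool (\<open>measure_PiM_tilt_empirical\<close>). The law of this random \<open>\<mu>\<close> is the mixing
  measure. Sampling without replacement is sampling with replacement conditioned on the absence of
  collisions, so the two laws differ by at most the collision probability. A single pool index has
  probability at most \<open>1 / (r\<^sub>i |K|)\<close>, which bounds the collision probability by
  \<open>k (k - 1) / (2 min r\<^sub>i |K|)\<close> (\<open>sum_inj_prod_ge\<close>, \<open>sample_without_replacement_close\<close>).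

  It remains to average \<open>1 / |K| \<le> 1 / (1 + |J|)\<close>. As \<open>1 / (1 + m) = \<integral>\<^sub>0\<^sup>1 t\<^sup>m dt\<close> and the coins are
  independent with success probabilities \<open>q\<^sub>i \<ge> r\<^sub>i\<close>, the mean is
  \<open>\<integral>\<^sub>0\<^sup>1 \<Prod>\<^sub>i (1 - q\<^sub>i (1 - t)) dt \<le> \<integral>\<^sub>0\<^sup>1 exp (- (1 - t) \<Sum>\<^sub>i r\<^sub>i) dt\<close>, which is the last factor of the bound
  (\<open>expected_inverse_Suc_count_le\<close>).

  The measure theory behind the word ``mixture'' is that the empirical measure depends
  continuously on the sample (\<open>measurable_empirical\<close>) and that \<open>\<mu> \<mapsto> \<Otimes>\<^sub>i T\<^sub>i \<mu>\<close> is a probability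
  kernel on the space of measures with its weak Borel structure (\<open>measurable_PiM_tilt\<close>).
\<close>

section \<open>Collisions and random subsets\<close>

text \<open>
  The birthday bound: if the \<open>f i\<close> are drawn independently with laws \<open>p i\<close> whose atoms have mass at
  most \<open>e\<close>, then a new draw hits one of the \<open>m\<close> earlier values with probability at most \<open>m e\<close>. Adding
  this up one index at a time gives the triangular number in front of \<open>e\<close>.
\<close>

lemma sum_inj_prod_ge:
  fixes p :: "'i \<Rightarrow> 'j \<Rightarrow> real"
  assumes "finite S" "finite K"
    and nonneg: "\<And>i j. i \<in> S \<Longrightarrow> j \<in> K \<Longrightarrow> 0 \<le> p i j"
    and total: "\<And>i. i \<in> S \<Longrightarrow> (\<Sum>j\<in>K. p i j) = 1"
    and le: "\<And>i j. i \<in> S \<Longrightarrow> j \<in> K \<Longrightarrow> p i j \<le> e"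
  shows "1 - real (card S) * (real (card S) - 1) / 2 * e
    \<le> (\<Sum>f | f \<in> S \<rightarrow>\<^sub>E K \<and> inj_on f S. \<Prod>i\<in>S. p i (f i))"
  using assms(1) nonneg total le
proof (induction S rule: finite_induct)
  case empty
  then show ?case by simp
next
  case (insert b S)
  let ?inj = "{g \<in> S \<rightarrow>\<^sub>E K. inj_on g S}"
  let ?w = "\<lambda>g. \<Prod>i\<in>S. p i (g i)"
  have fin: "finite (S \<rightarrow>\<^sub>E K)" "finite ?inj"
    using finite_PiE[of S "\<lambda>_. K"] insert.hyps \<open>finite K\<close> by (auto intro: finite_subset)
  obtain j0 where "j0 \<in> K"
    using insert.prems(2)[of b] by fastforce
  then have e: "0 \<le> e"
    using insert.prems(1,3)[of b j0] by auto
  have w_nonneg: "0 \<le> ?w g" if "g \<in> ?inj" for g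
    using that insert.prems(1) by (intro prod_nonneg) (auto dest: PiE_mem)
  have w_total: "(\<Sum>g\<in>?inj. ?w g) \<le> 1"
  proof -
    have "(\<Sum>g\<in>?inj. ?w g) \<le> (\<Sum>g\<in>S \<rightarrow>\<^sub>E K. ?w g)"
      using insert.prems(1) fin by (intro sum_mono2 prod_nonneg) (auto dest: PiE_mem)
    also have "\<dots> = (\<Prod>i\<in>S. \<Sum>j\<in>K. p i j)"
      using insert.hyps \<open>finite K\<close> by (simp add: prod_sum_PiE)
    also have "\<dots> = 1"
      using insert.prems(2) by simp
    finally show ?thesis .
  qed
  have fresh: "1 - real (card S) * e \<le> (\<Sum>y\<in>K - g ` S. p b y)" if "g \<in> ?inj" for g
  proof -
    have "(\<Sum>y\<in>g ` S. p b y) \<le> real (card (g ` S)) * e"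
      using that insert.prems(3)[of b] by (intro sum_bounded_above) (auto dest: PiE_mem)
    also have "card (g ` S) = card S"
      using that by (simp add: card_image)
    finally have "(\<Sum>y\<in>g ` S. p b y) \<le> real (card S) * e" .
    moreover have "(\<Sum>y\<in>K - g ` S. p b y) = 1 - (\<Sum>y\<in>g ` S. p b y)"
      using that insert.prems(2)[of b] \<open>finite K\<close>
      by (subst sum_diff) (auto dest: PiE_mem)
    ultimately show ?thesis by linarith
  qed
  \<comment> \<open>An injection on the larger set is an injection \<open>g\<close> on \<open>S\<close> together with an unused value.\<close>
  have "(\<Sum>f | f \<in> insert b S \<rightarrow>\<^sub>E K \<and> inj_on f (insert b S). \<Prod>i\<in>insert b S. p i (f i))
      = (\<Sum>(g, y)\<in>(SIGMA g:?inj. K - g ` S). ?w g * p b y)"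
  proof (rule sum.reindex_bij_witness[where
        i = "\<lambda>(g, y). g(b := y)" and j = "\<lambda>f. (restrict f S, f b)"], goal_cases)
    case (1 f)
    then have "f \<in> extensional (insert b S)" by (simp add: PiE_iff)
    then show ?case
      by (auto simp: fun_eq_iff extensional_def restrict_def)
  next
    case (2 f)
    then have "restrict f S \<in> S \<rightarrow>\<^sub>E K" "f b \<in> K" "inj_on f S" "f b \<notin> f ` S"
      using insert.hyps by (auto simp: PiE_iff inj_on_insert)
    then show ?case by auto
  next
    case (3 a)
    then obtain g y where a: "a = (g, y)" "g \<in> S \<rightarrow>\<^sub>E K" by auto
    then have "g \<in> extensional S" by (simp add: PiE_iff)
    then show ?case
      using insert.hyps unfolding a by (auto simp: fun_eq_iff extensional_def restrict_def)
  next
    case (4 a)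
    then obtain g y where a: "a = (g, y)" "g \<in> S \<rightarrow>\<^sub>E K" "inj_on g S" "y \<in> K" "y \<notin> g ` S"
      by auto
    have "(g(b := y)) ` S = g ` S" "inj_on (g(b := y)) S"
      using insert.hyps a by (auto simp: inj_on_def)
    moreover have "g(b := y) \<in> insert b S \<rightarrow>\<^sub>E K"
      using a by (intro PiE_fun_upd) auto
    moreover have "y \<notin> (g(b := y)) ` (S - {b})"
      using insert.hyps a(5) by auto
    ultimately show ?case
      unfolding a(1) by (simp add: inj_on_insert)
  next
    case (5 f)
    have "(\<Prod>i\<in>S. p i (restrict f S i)) = (\<Prod>i\<in>S. p i (f i))"
      by (intro prod.cong) auto
    then show ?case
      using insert.hyps by (simp add: mult.commute)
  qed
  also have "\<dots> = (\<Sum>g\<in>?inj. ?w g * (\<Sum>y\<in>K - g ` S. p b y))"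
    using fin \<open>finite K\<close> by (subst sum.Sigma[symmetric]) (auto simp: sum_distrib_left)
  also have "\<dots> \<ge> (\<Sum>g\<in>?inj. ?w g * (1 - real (card S) * e))"
    using fresh w_nonneg by (intro sum_mono mult_left_mono) auto
  also have "(\<Sum>g\<in>?inj. ?w g * (1 - real (card S) * e))
      = (\<Sum>g\<in>?inj. ?w g) - real (card S) * e * (\<Sum>g\<in>?inj. ?w g)"
    unfolding sum_distrib_right[symmetric] by (simp add: algebra_simps)
  also have "\<dots> \<ge> (1 - real (card S) * (real (card S) - 1) / 2 * e) - real (card S) * e * 1"
    using insert.IH insert.prems w_total e
    by (intro diff_mono mult_left_mono) auto
  finally show ?case
    using insert.hyps by (simp add: field_simps)
qed

text \<open>
  This identifies the last factor of the final bound, including its limiting value 1 at \<open>s = 0\<close>.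
\<close>

lemma has_integral_exp_unit:
  fixes s :: real
  shows "((\<lambda>t. exp (- (s * (1 - t)))) has_integral (if s = 0 then 1 else (1 - exp (- s)) / s)) {0..1}"
proof (cases "s = 0")
  case True
  then show ?thesis using has_integral_const_real[of "1::real" 0 1] by simp
next
  case False
  have "((\<lambda>t. exp (- (s * (1 - t)))) has_integral
      exp (- (s * (1 - 1))) / s - exp (- (s * (1 - 0))) / s) {0..1}"
    using False
    by (intro fundamental_theorem_of_calculus)
       (auto intro!: derivative_eq_intros simp: has_real_derivative_iff_has_vector_derivative[symmetric])
  then show ?thesis using False by (simp add: diff_divide_distrib)
qed

text \<open>
  The left-hand side is the mean of \<open>1 / (1 + N)\<close> for the number \<open>N\<close> of successes among independent
  trials with success probabilities \<open>q i\<close>. Writing the fraction as \<open>\<integral>\<^sub>0\<^sup>1 t\<^sup>N dt\<close> turns the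
  mean into the integral of the generating function of \<open>N\<close>, which is a product over the trials.
\<close>

lemma expected_inverse_Suc_count_le:
  fixes q r :: "'i \<Rightarrow> real"
  assumes "finite I" and r: "\<And>i. i \<in> I \<Longrightarrow> 0 \<le> r i"
    and rq: "\<And>i. i \<in> I \<Longrightarrow> r i \<le> q i" and q: "\<And>i. i \<in> I \<Longrightarrow> q i \<le> 1"
  shows "(\<Sum>J\<in>Pow I. (\<Prod>i\<in>J. q i) * (\<Prod>i\<in>I - J. 1 - q i) / (1 + real (card J)))
    \<le> (if (\<Sum>i\<in>I. r i) = 0 then 1 else (1 - exp (- (\<Sum>i\<in>I. r i))) / (\<Sum>i\<in>I. r i))"
proof -
  have fin: "finite J" if "J \<in> Pow I" for J
    using that \<open>finite I\<close> by (auto intro: finite_subset)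
  have "((\<lambda>t. \<Sum>J\<in>Pow I. (\<Prod>i\<in>J. q i) * (\<Prod>i\<in>I - J. 1 - q i) * t ^ card J) has_integral
      (\<Sum>J\<in>Pow I. (\<Prod>i\<in>J. q i) * (\<Prod>i\<in>I - J. 1 - q i) * (1 / (1 + real (card J))))) {0..1}"
  proof (intro has_integral_sum has_integral_mult_right)
    fix J :: "'i set"
    have "((\<lambda>t::real. t ^ card J) has_integral
        1 ^ Suc (card J) / Suc (card J) - 0 ^ Suc (card J) / Suc (card J)) {0..1}"
      by (intro fundamental_theorem_of_calculus)
         (auto intro!: derivative_eq_intros simp: has_real_derivative_iff_has_vector_derivative[symmetric]
           simp del: of_nat_Suc power_Suc)
    then show "((\<lambda>t::real. t ^ card J) has_integral 1 / (1 + real (card J))) {0..1}"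
      by simp
  qed (use \<open>finite I\<close> in simp)
  then have 1: "((\<lambda>t. \<Prod>i\<in>I. q i * t + (1 - q i)) has_integral
      (\<Sum>J\<in>Pow I. (\<Prod>i\<in>J. q i) * (\<Prod>i\<in>I - J. 1 - q i) / (1 + real (card J)))) {0..1}"
    using \<open>finite I\<close> by (simp add: prod_add prod.distrib mult_ac)
  have 2: "(\<Prod>i\<in>I. q i * t + (1 - q i)) \<le> exp (- ((\<Sum>i\<in>I. r i) * (1 - t)))"
    if t: "t \<in> {0..1}" for t
  proof -
    have "(\<Prod>i\<in>I. q i * t + (1 - q i)) \<le> (\<Prod>i\<in>I. exp (- (r i * (1 - t))))"
    proof (rule prod_mono, safe)
      fix i assume i: "i \<in> I"
      have qi: "0 \<le> q i" using r[OF i] rq[OF i] by linarith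
      then show "0 \<le> q i * t + (1 - q i)" using q[OF i] t by auto
      have "q i * t + (1 - q i) = 1 + - (q i * (1 - t))" by (simp add: algebra_simps)
      also have "\<dots> \<le> exp (- (q i * (1 - t)))" by (rule exp_ge_add_one_self)
      also have "\<dots> \<le> exp (- (r i * (1 - t)))"
        using rq[OF i] t by (simp add: mult_right_mono)
      finally show "q i * t + (1 - q i) \<le> exp (- (r i * (1 - t)))" .
    qed
    also have "\<dots> = exp (- ((\<Sum>i\<in>I. r i) * (1 - t)))"
      using \<open>finite I\<close> by (simp add: exp_sum[symmetric] sum_negf sum_distrib_right)
    finally show ?thesis .
  qed
  show ?thesis
    by (rule has_integral_le[OF 1 has_integral_exp_unit]) (use 2 in auto)
qed

lemma inj_on_extends_to_permutation:
  assumes "finite K" "A \<subseteq> K" "inj_on f A" "f ` A \<subseteq> K"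
  obtains \<pi> where "\<pi> permutes K" "\<And>i. i \<in> A \<Longrightarrow> \<pi> i = f i"
proof -
  have fin: "finite A" using assms by (auto intro: finite_subset)
  have "card (K - A) = card (K - f ` A)"
    using assms fin by (simp add: card_Diff_subset card_image)
  then obtain g where g: "bij_betw g (K - A) (K - f ` A)"
    using finite_same_card_bij[of "K - A" "K - f ` A"] assms(1) by auto
  let ?h = "\<lambda>i. if i \<in> A then f i else g i"
  let ?p = "\<lambda>i. if i \<in> K then ?h i else i"
  have "bij_betw ?h (A \<union> (K - A)) (f ` A \<union> (K - f ` A))"
    using g assms(3) by (intro bij_betw_disjoint_Un) (auto simp: bij_betw_def)
  then have "bij_betw ?h K K"
    using assms(2,4) by (simp add: Un_absorb1)
  then have "bij_betw ?p K K"
    by (subst bij_betw_cong[of _ _ ?h]) auto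
  then have "?p permutes K"
    by (intro bij_imp_permutes) auto
  then show thesis
    using assms(2) by (intro that[of ?p]) auto
qed

section \<open>The weak Borel structure and empirical measures\<close>

lemma weak_topology_subset: "{U. openin weak_topology U} \<subseteq> Pow (space (prob_algebra borel))"
proof safe
  fix U and \<mu> :: "'a measure" assume "openin weak_topology U" "\<mu> \<in> U"
  then have "\<mu> \<in> topspace (weak_topology :: 'a measure topology)"
    using openin_subset by blast
  then show "\<mu> \<in> space (prob_algebra borel)"
    unfolding weak_topology_def topology_generated_by_topspace by auto
qed

lemma space_weak_borel: "space weak_borel = space (prob_algebra borel)"
  unfolding weak_borel_def by (rule space_measure_of[OF weak_topology_subset])

lemma openin_weak_in_sets_weak_borel:
  "openin weak_topology U \<Longrightarrow> U \<in> sets weak_borel"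
  unfolding weak_borel_def by (auto simp: sets_measure_of[OF weak_topology_subset])

text \<open>
  Preimages of open sets under these maps are members of the subbasis that generates the topology.
\<close>

lemma borel_measurable_weak_integral:
  fixes f :: "'a::topological_space \<Rightarrow> real"
  assumes "continuous_on UNIV f" "bounded (range f)"
  shows "(\<lambda>\<mu>. \<integral>x. f x \<partial>\<mu>) \<in> borel_measurable weak_borel"
proof (rule borel_measurableI)
  fix V :: "real set" assume "open V"
  have "openin weak_topology {\<mu> \<in> space (prob_algebra borel). (\<integral>x. f x \<partial>\<mu>) \<in> V}"
    unfolding weak_topology_def using assms \<open>open V\<close>
    by (intro topology_generated_by_Basis) blast
  then have "{\<mu> \<in> space (prob_algebra borel). (\<integral>x. f x \<partial>\<mu>) \<in> V} \<in> sets weak_borel"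
    by (rule openin_weak_in_sets_weak_borel)
  then show "(\<lambda>\<mu>. \<integral>x. f x \<partial>\<mu>) -` V \<inter> space weak_borel \<in> sets weak_borel"
    by (simp add: space_weak_borel vimage_def Int_def conj_commute)
qed

lemma in_space_prob_algebraD:
  assumes "\<mu> \<in> space (prob_algebra M)"
  shows "prob_space \<mu>" "sets \<mu> = sets M" "space \<mu> = space M"
  using assms sets_eq_imp_space_eq by (auto simp: space_prob_algebra)

text \<open>
  On a metric space the indicator of a closed set is the pointwise limit of the bounded continuous
  functions \<open>max 0 (1 - m infdist x A)\<close>, so evaluation at a closed set is a limit of the maps of
  \<open>borel_measurable_weak_integral\<close>.
\<close>

lemma measurable_weak_borel_emeasure_closed:
  fixes A :: "'a::metric_space set"
  assumes "closed A"
  shows "(\<lambda>\<mu>. emeasure \<mu> A) \<in> borel_measurable weak_borel"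
proof (cases "A = {}")
  case False
  let ?f = "\<lambda>m x. max 0 (1 - real m * infdist x A)"
  have cont: "continuous_on UNIV (?f m)" for m
    by (intro continuous_intros)
  have bound: "\<bar>?f m x\<bar> \<le> 1" for m x
    using infdist_nonneg[of x A] by auto
  have "(\<lambda>m. \<integral>x. ?f m x \<partial>\<mu>) \<longlonglongrightarrow> measure \<mu> A" if \<mu>: "\<mu> \<in> space weak_borel" for \<mu>
  proof -
    note \<mu>' = in_space_prob_algebraD[OF \<mu>[unfolded space_weak_borel]]
    interpret prob_space \<mu> by fact
    have "(\<lambda>m. \<integral>x. ?f m x \<partial>\<mu>) \<longlonglongrightarrow> (\<integral>x. indicator A x \<partial>\<mu>)"
    proof (rule integral_dominated_convergence[where w = "\<lambda>_. 1"])
      show "AE x in \<mu>. (\<lambda>m. ?f m x) \<longlonglongrightarrow> indicator A x"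
      proof (rule AE_I2)
        fix x
        show "(\<lambda>m. ?f m x) \<longlonglongrightarrow> indicator A x"
        proof (cases "x \<in> A")
          case True
          then show ?thesis by simp
        next
          case x: False
          then have pos: "infdist x A > 0"
            using \<open>closed A\<close> False in_closed_iff_infdist_zero infdist_nonneg[of x A] by fastforce
          obtain m0 :: nat where m0: "1 / infdist x A < real m0"
            using reals_Archimedean2 by blast
          have "?f m x = 0" if "m \<ge> m0" for m
          proof -
            have "1 / infdist x A \<le> real m" using m0 that by linarith
            then show ?thesis using pos by (simp add: field_simps)
          qed
          then have "\<forall>\<^sub>F m in sequentially. ?f m x = 0"
            by (auto simp: eventually_sequentially)
          then show ?thesis using x by (simp add: tendsto_eventually)
        qed
      qed
    qed (use bound \<mu>' \<open>closed A\<close> in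
        \<open>auto simp: measurable_cong_sets[OF \<mu>'(2) refl] intro!: borel_measurable_continuous_onI cont\<close>)
    then show ?thesis using \<mu>' by simp
  qed
  moreover have "(\<lambda>\<mu>. \<integral>x. ?f m x \<partial>\<mu>) \<in> borel_measurable weak_borel" for m
    using bound[of m] by (intro borel_measurable_weak_integral cont boundedI[where B = 1]) auto
  ultimately have "(\<lambda>\<mu>. measure \<mu> A) \<in> borel_measurable weak_borel"
    by (rule borel_measurable_LIMSEQ_real)
  then have "(\<lambda>\<mu>. ennreal (measure \<mu> A)) \<in> borel_measurable weak_borel"
    by simp
  then show ?thesis
    by (rule measurable_cong[THEN iffD1, rotated])
       (auto simp: space_weak_borel dest!: in_space_prob_algebraD(1)
         intro!: finite_measure.emeasure_eq_measure[symmetric] prob_space.finite_measure)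
qed simp

text \<open>
  The weak Borel structure refines the \<open>\<sigma>\<close>-algebra generated by the evaluations. This makes
  kernels that are measurable for \<^const>\<open>prob_algebra\<close> available for mixtures over
  \<^const>\<open>weak_borel\<close>.
\<close>

lemma weak_borel_measurable_prob_algebra:
  "(\<lambda>\<mu>. \<mu>) \<in> weak_borel \<rightarrow>\<^sub>M prob_algebra (borel :: 'a::metric_space measure)"
proof (rule measurable_prob_algebra_generated[where \<Omega> = UNIV and G = "Collect closed"])
  show "sets (borel :: 'a measure) = sigma_sets UNIV (Collect closed)"
    unfolding borel_eq_closed by (simp add: sets_measure_of)
  show "Int_stable (Collect closed :: 'a set set)"
    by (auto simp: Int_stable_def)
qed (auto simp: space_weak_borel space_prob_algebra measurable_weak_borel_emeasure_closed)

definition empirical :: "'i set \<Rightarrow> ('i \<Rightarrow> 'a::topological_space) \<Rightarrow> 'a measure" where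
  "empirical K x = distr (measure_pmf (pmf_of_set K)) borel x"

lemma sets_empirical [simp]: "sets (empirical K x) = sets borel"
  and space_empirical [simp]: "space (empirical K x) = UNIV"
  by (simp_all add: empirical_def)

lemma prob_space_empirical: "prob_space (empirical K x)"
  unfolding empirical_def by (intro measure_pmf.prob_space_distr) simp

lemma empirical_in_space_prob_algebra: "empirical K x \<in> space (prob_algebra borel)"
  by (simp add: space_prob_algebra prob_space_empirical)

lemma integral_empirical:
  fixes f :: "'a::topological_space \<Rightarrow> real"
  assumes "finite K" "K \<noteq> {}" "f \<in> borel_measurable borel"
  shows "(\<integral>y. f y \<partial>empirical K x) = (\<Sum>j\<in>K. f (x j)) / real (card K)"
  unfolding empirical_def using assms
  by (subst integral_distr) (auto simp: integral_pmf_of_set)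

lemma nn_integral_empirical:
  assumes "finite K" "K \<noteq> {}" "f \<in> borel_measurable borel"
  shows "(\<integral>\<^sup>+y. f y \<partial>empirical K x) = (\<Sum>j\<in>K. f (x j)) / of_nat (card K)"
  unfolding empirical_def using assms
  by (subst nn_integral_distr) (auto simp: nn_integral_pmf_of_set)

text \<open>
  Integrals against the empirical measure are finite averages, hence continuous in the sample, so
  \<^const>\<open>empirical\<close> is continuous into the weak topology. An open set of that topology may be an
  uncountable union of basic ones; continuity handles it, whereas an argument with the subbasis
  and countable operations alone would not.
\<close>

lemma open_vimage_empirical:
  fixes U :: "'a::topological_space measure set"
  assumes "finite K" "K \<noteq> {}" "openin weak_topology U"
  shows "open (empirical K -` U)"
  using assms(3) unfolding weak_topology_def openin_topology_generated_by_iff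
proof induction
  case Empty
  then show ?case by simp
next
  case (Int a b)
  then show ?case by (simp add: open_Int)
next
  case (UN \<K>)
  then show ?case by (auto simp: vimage_Union)
next
  case (Basis s)
  then obtain f :: "'a \<Rightarrow> real" and V where s: "s = {\<mu> \<in> space (prob_algebra borel). (\<integral>x. f x \<partial>\<mu>) \<in> V}"
    and f: "continuous_on UNIV f" and V: "open V" by blast
  have "empirical K -` s = (\<lambda>x. (\<Sum>j\<in>K. f (x j)) / real (card K)) -` V"
    using assms(1,2) borel_measurable_continuous_onI[OF f]
    by (auto simp: s empirical_in_space_prob_algebra integral_empirical)
  moreover have "continuous_on UNIV (\<lambda>x. (\<Sum>j\<in>K. f (x j)) / real (card K))"
    using assms(1,2)
    by (intro continuous_intros continuous_on_compose2[OF f] continuous_on_coordinatewise_then_product) auto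
  ultimately show ?case
    using V by (simp add: open_vimage)
qed

text \<open>
  The open preimages live in the space of all functions on the countable index type, where second
  countability identifies the Borel sets with the product \<open>\<sigma>\<close>-algebra. A product over fewer
  indices maps measurably into it, the missing coordinates being constantly \<^const>\<open>undefined\<close>.
\<close>

lemma measurable_empirical:
  fixes K :: "'i::countable set"
  assumes "finite K" "K \<noteq> {}"
  shows "empirical K \<in> Pi\<^sub>M I (\<lambda>_. borel :: 'a::second_countable_topology measure) \<rightarrow>\<^sub>M weak_borel"
proof -
  have "empirical K \<in> (Pi\<^sub>M UNIV (\<lambda>_. borel :: 'a measure)) \<rightarrow>\<^sub>M weak_borel"
    unfolding weak_borel_def
  proof (rule measurable_measure_of[OF weak_topology_subset])
    show "empirical K \<in> space (Pi\<^sub>M UNIV (\<lambda>_. borel :: 'a measure)) \<rightarrow> space (prob_algebra borel)"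
      by (auto simp: empirical_in_space_prob_algebra)
    fix U :: "'a measure set" assume "U \<in> {U. openin weak_topology U}"
    then have "(empirical K -` U :: ('i \<Rightarrow> 'a) set) \<in> sets borel"
      by (intro borel_open open_vimage_empirical[OF assms]) simp
    then show "empirical K -` U \<inter> space (Pi\<^sub>M UNIV (\<lambda>_. borel)) \<in> sets (Pi\<^sub>M UNIV (\<lambda>_. borel))"
      by (simp add: sets_PiM_equal_borel space_PiM)
  qed
  moreover have "(\<lambda>x. x) \<in> Pi\<^sub>M I (\<lambda>_. borel :: 'a measure) \<rightarrow>\<^sub>M Pi\<^sub>M UNIV (\<lambda>_. borel)"
  proof (rule measurable_PiM_single')
    fix i :: 'i
    show "(\<lambda>x. x i) \<in> Pi\<^sub>M I (\<lambda>_. borel :: 'a measure) \<rightarrow>\<^sub>M borel"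
    proof (cases "i \<in> I")
      case False
      then have "(\<lambda>x. x i) \<in> Pi\<^sub>M I (\<lambda>_. borel :: 'a measure) \<rightarrow>\<^sub>M borel
          \<longleftrightarrow> (\<lambda>x. undefined :: 'a) \<in> Pi\<^sub>M I (\<lambda>_. borel :: 'a measure) \<rightarrow>\<^sub>M borel"
        by (intro measurable_cong) (auto simp: space_PiM PiE_iff extensional_def)
      then show ?thesis by simp
    qed simp
  qed simp
  ultimately show ?thesis
    using measurable_compose[of "\<lambda>x. x"] by blast
qed

section \<open>Tilted measures and their products\<close>

lemma weight_ratio_pos_bounds:
  assumes "l \<in> weights" "weight_ratio l > 0"
  obtains c s where "0 < c" "\<And>x. c \<le> l x" "\<And>x. l x \<le> s" "weight_ratio l = c / s"
proof -
  define a b where "a = (INF x. ennreal (l x))" and "b = (SUP x. ennreal (l x))"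
  have pos: "0 < l x" for x using assms(1) by (auto simp: weights_def)
  have ratio: "weight_ratio l = enn2real (a / b)"
    by (simp add: weight_ratio_def a_def b_def)
  have ab: "a \<le> ennreal (l x)" "ennreal (l x) \<le> b" for x
    by (auto simp: a_def b_def intro: INF_lower SUP_upper)
  have "a \<noteq> 0" using assms(2) ratio by auto
  moreover have "b \<noteq> \<top>" using assms(2) ratio by (auto simp: ennreal_divide_top)
  moreover have "a \<noteq> \<top>" using ab(1)[of undefined] by (auto simp: top_unique)
  ultimately have fin: "a = ennreal (enn2real a)" "b = ennreal (enn2real b)"
    by (simp_all add: less_top)
  define c s where "c = enn2real a" and "s = enn2real b"
  have "c \<noteq> 0" using \<open>a \<noteq> 0\<close> fin(1) unfolding c_def by fastforce
  then have c: "0 < c" unfolding c_def using enn2real_nonneg[of a] by linarith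
  have bounds: "c \<le> l x" "l x \<le> s" for x
  proof -
    have "ennreal c \<le> ennreal (l x)" "ennreal (l x) \<le> ennreal s"
      using ab[of x] fin unfolding c_def s_def by metis+
    moreover have "0 \<le> s" by (simp add: s_def)
    ultimately show "c \<le> l x" "l x \<le> s"
      using pos[of x] by (simp_all add: ennreal_le_iff2)
  qed
  have "0 < s" using c bounds[of undefined] by linarith
  have "a / b = ennreal c / ennreal s"
    using fin unfolding c_def s_def by metis
  also have "\<dots> = ennreal (c / s)"
    using c \<open>0 < s\<close> by (simp add: divide_ennreal)
  finally have "weight_ratio l = c / s"
    using c \<open>0 < s\<close> by (simp add: ratio)
  with c bounds show thesis by (rule that)
qed

text \<open>
  The bounds are required at every index of the type because the product measures of
  \<^locale>\<open>product_prob_space\<close> are formed from total families of probability measures.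
\<close>

locale bounded_weights =
  fixes l :: "'i \<Rightarrow> 'a::topological_space \<Rightarrow> real" and c s :: "'i \<Rightarrow> real"
  assumes measurable_weight: "l i \<in> borel_measurable borel"
    and lower_pos: "0 < c i"
    and lower: "c i \<le> l i y"
    and upper: "l i y \<le> s i"
begin

lemma weight_pos: "0 < l i y"
  using lower_pos[of i] lower[of i y] by linarith

lemma upper_pos: "0 < s i"
  using weight_pos[of i undefined] upper[of i undefined] by linarith

lemma
  assumes "\<mu> \<in> space (prob_algebra borel)"
  shows integrable_weight: "integrable \<mu> (l i)"
    and integral_weight_pos: "0 < (\<integral>y. l i y \<partial>\<mu>)"
proof -
  note \<mu> = in_space_prob_algebraD[OF assms]
  interpret prob_space \<mu> by fact
  have l: "l i \<in> borel_measurable \<mu>"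
    using measurable_weight \<mu>(2) by (simp add: measurable_cong_sets[OF \<mu>(2) refl])
  show int: "integrable \<mu> (l i)"
    using l upper weight_pos[of i]
    by (intro integrable_const_bound[where B = "s i"]) (auto simp: less_imp_le)
  have "(\<integral>y. c i \<partial>\<mu>) \<le> (\<integral>y. l i y \<partial>\<mu>)"
    using int lower by (intro integral_mono) auto
  then show "0 < (\<integral>y. l i y \<partial>\<mu>)"
    using lower_pos[of i] by (simp add: prob_space)
qed

lemma emeasure_tilt:
  assumes "\<mu> \<in> space (prob_algebra borel)" "A \<in> sets borel"
  shows "emeasure (tilt (l i) \<mu>) A
    = (\<integral>\<^sup>+y. ennreal (l i y) * indicator A y \<partial>\<mu>) / (\<integral>\<^sup>+y. ennreal (l i y) \<partial>\<mu>)"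
proof -
  note \<mu> = in_space_prob_algebraD[OF assms(1)]
  have [measurable]: "l i \<in> borel_measurable \<mu>" "A \<in> sets \<mu>"
    using measurable_weight \<mu>(2) assms(2) by (simp_all add: measurable_cong_sets[OF \<mu>(2) refl])
  have L: "(\<integral>\<^sup>+y. ennreal (l i y) \<partial>\<mu>) = ennreal (\<integral>y. l i y \<partial>\<mu>)"
    using integrable_weight[OF assms(1)] weight_pos[of i]
    by (intro nn_integral_eq_integral) (auto simp: less_imp_le)
  have "emeasure (tilt (l i) \<mu>) A
      = (\<integral>\<^sup>+y. ennreal (l i y) * indicator A y / ennreal (\<integral>y. l i y \<partial>\<mu>) \<partial>\<mu>)"
    unfolding tilt_def using integral_weight_pos[OF assms(1), of i] weight_pos[of i]
    by (subst emeasure_density)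
       (auto intro!: nn_integral_cong simp: divide_ennreal[symmetric] less_imp_le
         split: split_indicator)
  also have "\<dots> = (\<integral>\<^sup>+y. ennreal (l i y) * indicator A y \<partial>\<mu>) / ennreal (\<integral>y. l i y \<partial>\<mu>)"
    by (intro nn_integral_divide) measurable
  finally show ?thesis by (simp add: L)
qed

lemma sets_tilt [simp]: "sets (tilt (l i) \<mu>) = sets \<mu>"
  and space_tilt [simp]: "space (tilt (l i) \<mu>) = space \<mu>"
  by (simp_all add: tilt_def)

lemma prob_space_tilt:
  assumes "\<mu> \<in> space (prob_algebra borel)"
  shows "prob_space (tilt (l i) \<mu>)"
proof (rule prob_spaceI)
  note \<mu> = in_space_prob_algebraD[OF assms]
  have L: "(\<integral>\<^sup>+y. ennreal (l i y) \<partial>\<mu>) = ennreal (\<integral>y. l i y \<partial>\<mu>)"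
    using integrable_weight[OF assms] weight_pos[of i]
    by (intro nn_integral_eq_integral) (auto simp: less_imp_le)
  show "emeasure (tilt (l i) \<mu>) (space (tilt (l i) \<mu>)) = 1"
    using \<mu> integral_weight_pos[OF assms, of i]
    by (simp add: emeasure_tilt assms L divide_ennreal)
qed

lemma product_prob_space_tilt:
  "\<mu> \<in> space (prob_algebra borel) \<Longrightarrow> product_prob_space (\<lambda>i. tilt (l i) \<mu>)"
  by (intro product_prob_spaceI prob_space_tilt)

lemma sets_PiM_tilt:
  "\<mu> \<in> space (prob_algebra borel) \<Longrightarrow> sets (Pi\<^sub>M I (\<lambda>i. tilt (l i) \<mu>)) = sets (Pi\<^sub>M I (\<lambda>_. borel))"
  by (intro sets_PiM_cong) (auto dest: in_space_prob_algebraD(2))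

lemma prob_space_PiM_tilt:
  "\<mu> \<in> space (prob_algebra borel) \<Longrightarrow> prob_space (Pi\<^sub>M I (\<lambda>i. tilt (l i) \<mu>))"
  by (intro prob_space_PiM prob_space_tilt)

lemma emeasure_PiM_tilt:
  assumes "\<mu> \<in> space (prob_algebra borel)" "finite I" "\<And>i. i \<in> I \<Longrightarrow> A i \<in> sets borel"
  shows "emeasure (Pi\<^sub>M I (\<lambda>i. tilt (l i) \<mu>)) (Pi\<^sub>E I A) = (\<Prod>i\<in>I. emeasure (tilt (l i) \<mu>) (A i))"
proof -
  interpret product_prob_space "\<lambda>i. tilt (l i) \<mu>"
    by (rule product_prob_space_tilt) fact
  show ?thesis
    using assms(2,3) in_space_prob_algebraD(2)[OF assms(1)] by (intro emeasure_PiM) auto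
qed

end

text \<open>
  On a rectangle the product measure is a product of quotients of integrals, each depending
  measurably on \<open>\<mu>\<close>; rectangles form an intersection-stable generator.
\<close>

lemma (in bounded_weights) measurable_PiM_tilt:
  assumes "finite I"
    and \<M>: "(\<lambda>\<mu>. \<mu>) \<in> \<M> \<rightarrow>\<^sub>M prob_algebra borel"
  shows "(\<lambda>\<mu>. Pi\<^sub>M I (\<lambda>i. tilt (l i) \<mu>)) \<in> \<M> \<rightarrow>\<^sub>M prob_algebra (Pi\<^sub>M I (\<lambda>_. borel))"
proof (rule measurable_prob_algebra_generated[where G = "prod_algebra I (\<lambda>_. borel)"
      and \<Omega> = "I \<rightarrow>\<^sub>E UNIV"])
  have in_space: "\<mu> \<in> space (prob_algebra borel)" if "\<mu> \<in> space \<M>" for \<mu>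
    using measurable_space[OF \<M> that] .
  have tilt: "(\<lambda>\<mu>. emeasure (tilt (l i) \<mu>) A) \<in> borel_measurable \<M>" if A: "A \<in> sets borel" for i A
  proof -
    note [measurable] = A measurable_weight[of i]
    have "(\<lambda>\<mu>. (\<integral>\<^sup>+y. ennreal (l i y) * indicator A y \<partial>\<mu>) / (\<integral>\<^sup>+y. ennreal (l i y) \<partial>\<mu>))
        \<in> borel_measurable \<M>"
      by (intro borel_measurable_divide_ennreal
          measurable_compose[OF measurable_prob_algebraD[OF \<M>] nn_integral_measurable_subprob_algebra])
         measurable
    then show ?thesis
      by (rule measurable_cong[THEN iffD1, rotated]) (simp add: emeasure_tilt A in_space)
  qed
  fix A :: "('i \<Rightarrow> 'a) set" assume "A \<in> prod_algebra I (\<lambda>_. borel)"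
  then obtain E where E: "A = Pi\<^sub>E I E" "\<And>i. i \<in> I \<Longrightarrow> E i \<in> sets borel"
    using \<open>finite I\<close> by (auto simp: prod_algebra_eq_finite)
  have "(\<lambda>\<mu>. \<Prod>i\<in>I. emeasure (tilt (l i) \<mu>) (E i)) \<in> borel_measurable \<M>"
    using tilt E(2) by (intro borel_measurable_prod_ennreal) auto
  then show "(\<lambda>\<mu>. emeasure (Pi\<^sub>M I (\<lambda>i. tilt (l i) \<mu>)) A) \<in> borel_measurable \<M>"
    by (rule measurable_cong[THEN iffD1, rotated])
       (simp add: E emeasure_PiM_tilt in_space \<open>finite I\<close>)
next
  show "sets (Pi\<^sub>M I (\<lambda>i. tilt (l i) \<mu>)) = sets (Pi\<^sub>M I (\<lambda>_. borel))" if "\<mu> \<in> space \<M>" for \<mu>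
    by (intro sets_PiM_tilt measurable_space[OF \<M> that])
qed (use measurable_space[OF \<M>] prod_algebra_sets_into_space[of I "\<lambda>_. borel"] in
    \<open>auto simp: sets_PiM Int_stable_prod_algebra prob_space_PiM_tilt\<close>)

text \<open>
  The mass that the tilted empirical measure of the points \<open>x j\<close>, \<open>j \<in> K\<close>, gives to the index \<open>j\<close>.
  Masses are attached to indices because equal points may occur several times.
\<close>

definition share :: "('a \<Rightarrow> real) \<Rightarrow> 'j set \<Rightarrow> ('j \<Rightarrow> 'a) \<Rightarrow> 'j \<Rightarrow> real" where
  "share w K x j = w (x j) / (\<Sum>j'\<in>K. w (x j'))"

context bounded_weights
begin

lemma sum_weight_pos: "finite K \<Longrightarrow> K \<noteq> {} \<Longrightarrow> 0 < (\<Sum>j\<in>K. l i (x j))"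
  by (intro sum_pos weight_pos)

lemma share_nonneg: "finite K \<Longrightarrow> K \<noteq> {} \<Longrightarrow> 0 \<le> share (l i) K x j"
  using sum_weight_pos[of K i x] weight_pos[of i "x j"] by (simp add: share_def)

lemma sum_share: "finite K \<Longrightarrow> K \<noteq> {} \<Longrightarrow> (\<Sum>j\<in>K. share (l i) K x j) = 1"
  using sum_weight_pos[of K i x] by (simp add: share_def sum_divide_distrib[symmetric])

lemma share_le:
  assumes "finite K" "K \<noteq> {}"
  shows "share (l i) K x j \<le> 1 / (c i / s i * real (card K))"
proof -
  have "real (card K) * c i \<le> (\<Sum>j\<in>K. l i (x j))"
    by (intro sum_bounded_below lower)
  moreover have "0 < real (card K) * c i"
    using assms lower_pos by (simp add: card_gt_0_iff)
  ultimately have "share (l i) K x j \<le> s i / (real (card K) * c i)"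
    unfolding share_def using upper[of i "x j"] weight_pos[of i "x j"] upper_pos[of i]
    by (intro frac_le) auto
  then show ?thesis by (simp add: mult.commute)
qed

lemma emeasure_tilt_empirical:
  assumes "finite K" "K \<noteq> {}" "A \<in> sets borel"
  shows "emeasure (tilt (l i) (empirical K x)) A
    = ennreal (\<Sum>j\<in>K. share (l i) K x j * indicator A (x j))"
proof -
  have m: "0 < real (card K)" using assms by (simp add: card_gt_0_iff)
  note [measurable] = assms(3) measurable_weight[of i]
  have "emeasure (tilt (l i) (empirical K x)) A
      = (\<integral>\<^sup>+y. ennreal (l i y * indicator A y / ((\<Sum>j\<in>K. l i (x j)) / real (card K))) \<partial>empirical K x)"
    unfolding tilt_def using assms
    by (subst emeasure_density)
       (auto simp: integral_empirical measurable_cong_sets[OF sets_empirical refl]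
         indicator_def of_bool_def intro!: nn_integral_cong split: if_splits)
  also have "\<dots> = (\<Sum>j\<in>K. ennreal (l i (x j) * indicator A (x j) / ((\<Sum>j\<in>K. l i (x j)) / real (card K))))
      / ennreal (real (card K))"
    using assms by (subst nn_integral_empirical) (auto simp: ennreal_of_nat_eq_real_of_nat)
  also have "\<dots> = ennreal ((\<Sum>j\<in>K. l i (x j) * indicator A (x j) / ((\<Sum>j\<in>K. l i (x j)) / real (card K)))
      / real (card K))"
    using m weight_pos[of i] sum_weight_pos[OF assms(1,2), of i x]
    by (subst sum_ennreal) (auto simp: divide_ennreal less_imp_le intro!: divide_ennreal sum_nonneg)
  also have "(\<Sum>j\<in>K. l i (x j) * indicator A (x j) / ((\<Sum>j\<in>K. l i (x j)) / real (card K)))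
      / real (card K) = (\<Sum>j\<in>K. share (l i) K x j * indicator A (x j))"
    using m by (subst sum_divide_distrib) (simp add: share_def)
  finally show ?thesis .
qed

text \<open>
  The product of tilted empirical measures is weighted sampling with replacement: it is the image
  of the discrete law on maps \<open>f : S \<rightarrow> K\<close> that draws the \<open>f i\<close> independently according to the
  shares. Both measures agree on rectangles by expanding a product of sums.
\<close>

lemma measure_PiM_tilt_empirical:
  assumes "finite K" "K \<noteq> {}" "finite S" and B: "B \<in> sets (Pi\<^sub>M S (\<lambda>_. borel))"
  shows "measure (Pi\<^sub>M S (\<lambda>i. tilt (l i) (empirical K x))) B
    = (\<Sum>f\<in>S \<rightarrow>\<^sub>E K. (\<Prod>i\<in>S. share (l i) K x (f i)) * indicator B (\<lambda>i\<in>S. x (f i)))"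
proof -
  let ?M = "\<lambda>i. tilt (l i) (empirical K x)"
  let ?w = "\<lambda>f. \<Prod>i\<in>S. share (l i) K x (f i)"
  let ?g = "\<lambda>f. \<lambda>i\<in>S. x (f i)"
  let ?D = "distr (point_measure (S \<rightarrow>\<^sub>E K) (\<lambda>f. ennreal (?w f))) (Pi\<^sub>M S (\<lambda>_. borel)) ?g"
  have fin: "finite (S \<rightarrow>\<^sub>E K)"
    using assms by (intro finite_PiE) auto
  have w_nonneg: "0 \<le> ?w f" for f
    using assms by (intro prod_nonneg share_nonneg ballI) auto
  have D: "emeasure ?D C = ennreal (\<Sum>f\<in>S \<rightarrow>\<^sub>E K. ?w f * indicator C (?g f))"
    if C: "C \<in> sets (Pi\<^sub>M S (\<lambda>_. borel))" for C
  proof -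
    have "emeasure ?D C = emeasure (point_measure (S \<rightarrow>\<^sub>E K) (\<lambda>f. ennreal (?w f)))
        {f \<in> S \<rightarrow>\<^sub>E K. ?g f \<in> C}"
      using C by (subst emeasure_distr)
        (auto simp: measurable_point_measure_eq1 space_PiM space_point_measure intro!: arg_cong2[where f = emeasure])
    also have "\<dots> = (\<Sum>f | f \<in> S \<rightarrow>\<^sub>E K \<and> ?g f \<in> C. ennreal (?w f))"
      using fin by (intro emeasure_point_measure_finite) auto
    also have "\<dots> = ennreal (\<Sum>f | f \<in> S \<rightarrow>\<^sub>E K \<and> ?g f \<in> C. ?w f)"
      using w_nonneg by (intro sum_ennreal)
    also have "(\<Sum>f | f \<in> S \<rightarrow>\<^sub>E K \<and> ?g f \<in> C. ?w f) = (\<Sum>f\<in>S \<rightarrow>\<^sub>E K. ?w f * indicator C (?g f))"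
      using fin by (intro sum.mono_neutral_cong_left) auto
    finally show ?thesis .
  qed
  interpret product_prob_space ?M
    by (rule product_prob_space_tilt[OF empirical_in_space_prob_algebra])
  have "?D = Pi\<^sub>M S ?M"
  proof (rule PiM_eqI)
    show "sets ?D = sets (Pi\<^sub>M S ?M)"
      by (simp add: sets_PiM_tilt empirical_in_space_prob_algebra)
    fix A assume A: "\<And>i. i \<in> S \<Longrightarrow> A i \<in> sets (?M i)"
    have "emeasure ?D (Pi\<^sub>E S A) = ennreal (\<Sum>f\<in>S \<rightarrow>\<^sub>E K. ?w f * indicator (Pi\<^sub>E S A) (?g f))"
      using A \<open>finite S\<close> by (intro D sets_PiM_I_finite) auto
    also have "(\<Sum>f\<in>S \<rightarrow>\<^sub>E K. ?w f * indicator (Pi\<^sub>E S A) (?g f))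
        = (\<Sum>f\<in>S \<rightarrow>\<^sub>E K. \<Prod>i\<in>S. share (l i) K x (f i) * indicator (A i) (x (f i)))"
    proof (rule sum.cong)
      fix f
      have "indicator (Pi\<^sub>E S A) (?g f) = (of_bool (\<forall>i\<in>S. x (f i) \<in> A i) :: real)"
        by (auto simp: indicator_def PiE_iff)
      also have "\<dots> = (\<Prod>i\<in>S. indicator (A i) (x (f i)))"
        using \<open>finite S\<close> by (induction S rule: finite_induct) (auto simp: indicator_def)
      finally have "indicator (Pi\<^sub>E S A) (?g f) = (\<Prod>i\<in>S. indicator (A i) (x (f i)) :: real)" .
      then show "?w f * indicator (Pi\<^sub>E S A) (?g f)
          = (\<Prod>i\<in>S. share (l i) K x (f i) * indicator (A i) (x (f i)))"
        by (simp add: prod.distrib)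
    qed simp
    also have "\<dots> = (\<Prod>i\<in>S. \<Sum>j\<in>K. share (l i) K x j * indicator (A i) (x j))"
      using assms by (subst prod_sum_PiE) auto
    also have "ennreal \<dots> = (\<Prod>i\<in>S. ennreal (\<Sum>j\<in>K. share (l i) K x j * indicator (A i) (x j)))"
      using assms by (intro prod_ennreal[symmetric] sum_nonneg mult_nonneg_nonneg share_nonneg) auto
    also have "\<dots> = (\<Prod>i\<in>S. emeasure (?M i) (A i))"
      using A assms by (intro prod.cong) (auto simp: emeasure_tilt_empirical)
    finally show "emeasure ?D (Pi\<^sub>E S A) = (\<Prod>i\<in>S. emeasure (?M i) (A i))" .
  qed fact
  then have "emeasure (Pi\<^sub>M S ?M) B = ennreal (\<Sum>f\<in>S \<rightarrow>\<^sub>E K. ?w f * indicator B (?g f))"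
    using D[OF B] by simp
  then show ?thesis
    using w_nonneg by (simp add: measure_def sum_nonneg)
qed

end

section \<open>Sampling without replacement from an exchangeable pool\<close>

text \<open>
  Conditioning a probability on an event \<open>G\<close> changes the mean of a \<open>[0,1]\<close>-valued function by at
  most the probability of the complement of \<open>G\<close>: with \<open>T\<close> the part of the mean on \<open>G\<close> and \<open>D\<close> the
  probability of \<open>G\<close>, the gain \<open>T / D - T\<close> and the loss on the complement both lie between
  \<open>0\<close> and \<open>1 - D\<close>.
\<close>

lemma abs_conditioned_mean_diff_le:
  fixes w b :: "'f \<Rightarrow> real"
  assumes "finite F" "G \<subseteq> F"
    and w: "\<And>f. f \<in> F \<Longrightarrow> 0 \<le> w f" and total: "(\<Sum>f\<in>F. w f) = 1" and pos: "0 < (\<Sum>f\<in>G. w f)"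
    and b: "\<And>f. f \<in> F \<Longrightarrow> 0 \<le> b f" "\<And>f. f \<in> F \<Longrightarrow> b f \<le> 1"
  shows "\<bar>(\<Sum>f\<in>G. w f * b f) / (\<Sum>f\<in>G. w f) - (\<Sum>f\<in>F. w f * b f)\<bar> \<le> 1 - (\<Sum>f\<in>G. w f)"
proof -
  define D T R where "D = (\<Sum>f\<in>G. w f)" and "T = (\<Sum>f\<in>G. w f * b f)"
    and "R = (\<Sum>f\<in>F - G. w f * b f)"
  have "0 \<le> T" "T \<le> D"
    unfolding T_def D_def using assms(2) w b
    by (auto intro!: sum_nonneg sum_mono mult_left_le)
  then have "0 \<le> T / D" "T / D \<le> 1"
    using pos by (simp_all add: D_def[symmetric])
  have rest: "(\<Sum>f\<in>F - G. w f) = 1 - D"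
    using total assms(1,2) by (simp add: sum_diff D_def)
  have R: "0 \<le> R" "R \<le> 1 - D"
    unfolding R_def rest[symmetric] using w b
    by (auto intro!: sum_nonneg sum_mono mult_left_le)
  have "0 \<le> 1 - D" using R by linarith
  then have "0 \<le> T / D * (1 - D)"
    using \<open>0 \<le> T / D\<close> by (intro mult_nonneg_nonneg)
  moreover have "T / D * (1 - D) \<le> 1 - D"
    by (intro mult_left_le_one_le) fact+
  moreover have "T / D * (1 - D) = T / D - T"
    using pos by (simp add: D_def[symmetric] field_simps)
  moreover have "(\<Sum>f\<in>F. w f * b f) = T + R"
    unfolding T_def R_def using assms(1,2) by (simp add: sum.subset_diff add.commute)
  ultimately show ?thesis
    unfolding D_def[symmetric] T_def[symmetric] using R by linarith
qed

lemma integral_permute_exchangeable: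
  fixes F :: "(nat \<Rightarrow> 'a::topological_space) \<Rightarrow> real"
  assumes "exchangeable n M" "sets M = sets (seq_space n)" "\<pi> permutes {1..n}"
    and "F \<in> borel_measurable (seq_space n)"
  shows "(\<integral>x. F (\<lambda>i\<in>{1..n}. x (\<pi> i)) \<partial>M) = (\<integral>x. F x \<partial>M)"
proof -
  have "(\<lambda>x. \<lambda>i\<in>{1..n}. x (\<pi> i)) \<in> seq_space n \<rightarrow>\<^sub>M (seq_space n :: (nat \<Rightarrow> 'a) measure)"
    using permutes_in_image[OF assms(3)]
    by (intro measurable_restrict measurable_component_singleton) auto
  then have "(\<lambda>x. \<lambda>i\<in>{1..n}. x (\<pi> i)) \<in> M \<rightarrow>\<^sub>M seq_space n"
    by (simp add: measurable_cong_sets[OF assms(2) refl])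
  then have "(\<integral>x. F x \<partial>distr M (seq_space n) (\<lambda>x. \<lambda>i\<in>{1..n}. x (\<pi> i)))
      = (\<integral>x. F (\<lambda>i\<in>{1..n}. x (\<pi> i)) \<partial>M)"
    using assms(4) by (rule integral_distr)
  moreover have "distr M (seq_space n) (\<lambda>x. \<lambda>i\<in>{1..n}. x (\<pi> i)) = M"
    using assms(1,3) by (simp add: exchangeable_def)
  ultimately show ?thesis by simp
qed

context bounded_weights
begin

definition sampling_weight :: "'i set \<Rightarrow> ('j \<Rightarrow> 'a) \<Rightarrow> ('i \<Rightarrow> 'j) \<Rightarrow> real" where
  "sampling_weight S x f = (\<Prod>i\<in>S. l i (x (f i)))"

definition injections :: "'i set \<Rightarrow> 'j set \<Rightarrow> ('i \<Rightarrow> 'j) set" where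
  "injections S K = {f \<in> S \<rightarrow>\<^sub>E K. inj_on f S}"

text \<open>
  The probability of \<open>B\<close> for a sample from the pool \<open>x j\<close>, \<open>j \<in> K\<close>, in which an injection \<open>f\<close> is chosen
  with probability proportional to its sampling weight.
\<close>

definition sample_without_replacement :: "'i set \<Rightarrow> 'j set \<Rightarrow> ('i \<Rightarrow> 'a) set \<Rightarrow> ('j \<Rightarrow> 'a) \<Rightarrow> real" where
  "sample_without_replacement S K B x =
    (\<Sum>f\<in>injections S K. sampling_weight S x f * indicator B (\<lambda>i\<in>S. x (f i)))
      / (\<Sum>f\<in>injections S K. sampling_weight S x f)"

lemma finite_injections: "finite S \<Longrightarrow> finite K \<Longrightarrow> finite (injections S K)"
  unfolding injections_def by (rule finite_subset[of _ "S \<rightarrow>\<^sub>E K"]) (auto intro: finite_PiE)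

lemma sampling_weight_pos: "0 < sampling_weight S x f"
  unfolding sampling_weight_def by (intro prod_pos weight_pos)

lemma sampling_weight_le: "sampling_weight S x f \<le> (\<Prod>i\<in>S. s i)"
  unfolding sampling_weight_def
  by (intro prod_mono) (auto simp: upper less_imp_le[OF weight_pos])

lemma sample_without_replacement_bounds:
  "0 \<le> sample_without_replacement S K B x" "sample_without_replacement S K B x \<le> 1"
proof -
  show "0 \<le> sample_without_replacement S K B x"
    unfolding sample_without_replacement_def
    by (auto intro!: divide_nonneg_nonneg sum_nonneg mult_nonneg_nonneg simp: less_imp_le[OF sampling_weight_pos])
  have "(\<Sum>f\<in>injections S K. sampling_weight S x f * indicator B (\<lambda>i\<in>S. x (f i)))
      \<le> (\<Sum>f\<in>injections S K. sampling_weight S x f)"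
    by (intro sum_mono mult_left_le) (auto simp: less_imp_le[OF sampling_weight_pos])
  moreover have "0 \<le> (\<Sum>f\<in>injections S K. sampling_weight S x f)"
    by (auto intro!: sum_nonneg simp: less_imp_le[OF sampling_weight_pos])
  ultimately show "sample_without_replacement S K B x \<le> 1"
    unfolding sample_without_replacement_def by (auto simp: divide_le_eq_1)
qed

lemma measurable_sampling:
  assumes "f \<in> S \<rightarrow> I"
  shows "(\<lambda>x. sampling_weight S x f) \<in> borel_measurable (Pi\<^sub>M I (\<lambda>_. borel))"
    and "(\<lambda>x. \<lambda>i\<in>S. x (f i)) \<in> Pi\<^sub>M I (\<lambda>_. borel) \<rightarrow>\<^sub>M Pi\<^sub>M S (\<lambda>_. borel :: 'a measure)"
proof -
  show "(\<lambda>x. sampling_weight S x f) \<in> borel_measurable (Pi\<^sub>M I (\<lambda>_. borel))"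
    unfolding sampling_weight_def using assms
    by (intro borel_measurable_prod measurable_compose[OF _ measurable_weight] measurable_component_singleton)
       auto
  show "(\<lambda>x. \<lambda>i\<in>S. x (f i)) \<in> Pi\<^sub>M I (\<lambda>_. borel) \<rightarrow>\<^sub>M Pi\<^sub>M S (\<lambda>_. borel :: 'a measure)"
    using assms by (intro measurable_restrict measurable_component_singleton) auto
qed

lemma measurable_sampling_term:
  assumes "f \<in> S \<rightarrow> I" "B \<in> sets (Pi\<^sub>M S (\<lambda>_. borel))"
  shows "(\<lambda>x. sampling_weight S x f * indicator B (\<lambda>i\<in>S. x (f i)))
    \<in> borel_measurable (Pi\<^sub>M I (\<lambda>_. borel))"
  using assms
  by (intro borel_measurable_times measurable_sampling(1)
      measurable_compose[OF measurable_sampling(2) borel_measurable_indicator])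

lemma measurable_sample_without_replacement:
  assumes "K \<subseteq> I" "B \<in> sets (Pi\<^sub>M S (\<lambda>_. borel))"
  shows "sample_without_replacement S K B \<in> borel_measurable (Pi\<^sub>M I (\<lambda>_. borel))"
proof -
  have "f \<in> S \<rightarrow> I" if "f \<in> injections S K" for f
    using that assms(1) by (auto simp: injections_def PiE_iff)
  then show ?thesis
    unfolding sample_without_replacement_def[abs_def] using assms(2)
    by (intro borel_measurable_divide borel_measurable_sum measurable_sampling_term measurable_sampling(1))
qed

text \<open>
  Permuting the pool permutes the injections into it.
\<close>

lemma sample_without_replacement_permute:
  assumes \<pi>: "\<pi> permutes K" and y: "\<And>j. j \<in> K \<Longrightarrow> y j = x (\<pi> j)"
  shows "sample_without_replacement S K B y = sample_without_replacement S K B x"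
proof -
  have inv: "inv \<pi> permutes K" "\<pi> (inv \<pi> j) = j" "inv \<pi> (\<pi> j) = j" for j
    using \<pi> by (simp_all add: permutes_inv permutes_inverses)
  have mem: "(\<lambda>i\<in>S. \<sigma> (f i)) \<in> injections S K" if "\<sigma> permutes K" "f \<in> injections S K" for \<sigma> f
  proof -
    have "inj_on (\<lambda>i. \<sigma> (f i)) S"
      using that injD[OF permutes_inj[OF that(1)]] by (auto simp: injections_def inj_on_def)
    then show ?thesis
      using that permutes_in_image[OF that(1)] by (auto simp: injections_def PiE_iff)
  qed
  have reindex: "(\<Sum>f\<in>injections S K. h (\<lambda>i\<in>S. \<pi> (f i))) = (\<Sum>f\<in>injections S K. h f)"
    for h :: "_ \<Rightarrow> real"
  proof (rule sum.reindex_bij_witness[where i = "\<lambda>f. \<lambda>i\<in>S. inv \<pi> (f i)" and j = "\<lambda>f. \<lambda>i\<in>S. \<pi> (f i)"])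
    fix f assume "f \<in> injections S K"
    then have "f \<in> extensional S" by (auto simp: injections_def PiE_iff)
    then show "(\<lambda>i\<in>S. inv \<pi> ((\<lambda>i\<in>S. \<pi> (f i)) i)) = f" "(\<lambda>i\<in>S. \<pi> ((\<lambda>i\<in>S. inv \<pi> (f i)) i)) = f"
      using inv by (auto simp: fun_eq_iff extensional_def)
  qed (use mem \<pi> inv in auto)
  have y': "y (f i) = x (\<pi> (f i))" if "f \<in> injections S K" "i \<in> S" for f i
    using that y[of "f i"] by (auto simp: injections_def PiE_iff)
  have "sampling_weight S y f = sampling_weight S x (\<lambda>i\<in>S. \<pi> (f i))"
    "(\<lambda>i\<in>S. y (f i)) = (\<lambda>i\<in>S. x ((\<lambda>i\<in>S. \<pi> (f i)) i))" if "f \<in> injections S K" for f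
    using y'[OF that] by (auto simp: sampling_weight_def intro!: prod.cong)
  then show ?thesis
    unfolding sample_without_replacement_def
    using reindex[of "\<lambda>f. sampling_weight S x f * indicator B (\<lambda>i\<in>S. x (f i))"]
      reindex[of "sampling_weight S x"]
    by (simp cong: sum.cong)
qed

text \<open>
  The products of shares are the sampling weights divided by a common constant \<open>Z\<close>, so sampling
  without replacement is the product measure conditioned on injectivity, and the collision bound
  applies with atoms of mass at most \<open>1 / (r |K|)\<close>.
\<close>

lemma sample_without_replacement_close:
  assumes "finite K" "K \<noteq> {}" "finite S" "injections S K \<noteq> {}"
    and B: "B \<in> sets (Pi\<^sub>M S (\<lambda>_. borel))"
    and r: "0 < r" "\<And>i. i \<in> S \<Longrightarrow> r \<le> c i / s i"
  shows "\<bar>sample_without_replacement S K B x - measure (Pi\<^sub>M S (\<lambda>i. tilt (l i) (empirical K x))) B\<bar>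
    \<le> real (card S) * (real (card S) - 1) / (2 * r) / real (card K)"
proof -
  let ?w = "\<lambda>f. \<Prod>i\<in>S. share (l i) K x (f i)"
  let ?b = "\<lambda>f. indicator B (\<lambda>i\<in>S. x (f i)) :: real"
  define Z where "Z = (\<Prod>i\<in>S. \<Sum>j\<in>K. l i (x j))"
  have Z: "0 < Z"
    unfolding Z_def using assms by (intro prod_pos sum_weight_pos)
  have w: "?w f = sampling_weight S x f / Z" for f
    by (simp add: share_def sampling_weight_def Z_def prod_dividef)
  have m: "0 < real (card K)" using assms by (simp add: card_gt_0_iff)
  have fin: "finite (S \<rightarrow>\<^sub>E K)" using assms by (intro finite_PiE) auto
  have w_pos: "0 < ?w f" for f
    unfolding w by (intro divide_pos_pos sampling_weight_pos Z)
  have 1: "sample_without_replacement S K B x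
      = (\<Sum>f\<in>injections S K. ?w f * ?b f) / (\<Sum>f\<in>injections S K. ?w f)"
    using Z unfolding w sample_without_replacement_def
    by (simp add: sum_divide_distrib[symmetric])
  have 2: "\<bar>(\<Sum>f\<in>injections S K. ?w f * ?b f) / (\<Sum>f\<in>injections S K. ?w f)
      - (\<Sum>f\<in>S \<rightarrow>\<^sub>E K. ?w f * ?b f)\<bar> \<le> 1 - (\<Sum>f\<in>injections S K. ?w f)"
  proof (rule abs_conditioned_mean_diff_le[OF fin])
    show "(\<Sum>f\<in>S \<rightarrow>\<^sub>E K. ?w f) = 1"
      using assms by (subst prod_sum_PiE[symmetric]) (auto simp: sum_share)
    show "0 < (\<Sum>f\<in>injections S K. ?w f)"
      using assms finite_injections by (intro sum_pos w_pos)
  qed (auto simp: injections_def less_imp_le[OF w_pos])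
  have "share (l i) K x j \<le> 1 / (r * real (card K))" if "i \<in> S" for i j
  proof -
    have "1 / (c i / s i * real (card K)) \<le> 1 / (r * real (card K))"
      using r m that by (intro divide_left_mono mult_right_mono mult_pos_pos)
        (auto simp: lower_pos upper_pos)
    with share_le[OF assms(1,2), of i x j] show ?thesis by linarith
  qed
  then have "1 - real (card S) * (real (card S) - 1) / 2 * (1 / (r * real (card K)))
      \<le> (\<Sum>f\<in>injections S K. ?w f)"
    unfolding injections_def using assms
    by (intro sum_inj_prod_ge) (auto simp: share_nonneg sum_share)
  then show ?thesis
    unfolding measure_PiM_tilt_empirical[OF assms(1-3) B] 1 using 2
    by (simp add: mult_ac)
qed

end

text \<open>
  This is where exchangeability enters. Let the density with respect to the exchangeable measure
  \<open>M\<close> be the sampling weight of \<open>S\<close> times a function \<open>h\<close> that permutations of \<open>K\<close> leave unchanged. For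
  every injection \<open>f : S \<rightarrow> K\<close>, extended to a permutation of \<open>K\<close>, invariance of \<open>M\<close> replaces
  \<open>x\<^sub>i\<close> by \<open>x\<^bsub>f i\<^esub>\<close> for \<open>i \<in> S\<close> under the integral. Summing over all \<open>f\<close> turns the indicator of \<open>B\<close> into the numerator
  of \<open>sample_without_replacement\<close>; its denominator arises in the same way on the right-hand
  side, where the quotient itself is a symmetric function of the pool.
\<close>

lemma (in bounded_weights) integral_sample_without_replacement:
  fixes M :: "('i \<Rightarrow> 'a) measure" and h :: "('i \<Rightarrow> 'a) \<Rightarrow> real"
  assumes "finite_measure M" and sets_M: "sets M = sets (Pi\<^sub>M I (\<lambda>_. borel))"
    and perm: "\<And>\<pi> F :: ('i \<Rightarrow> 'a) \<Rightarrow> real. \<pi> permutes I \<Longrightarrow> F \<in> borel_measurable (Pi\<^sub>M I (\<lambda>_. borel)) \<Longrightarrow>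
        (\<integral>x. F (\<lambda>i\<in>I. x (\<pi> i)) \<partial>M) = (\<integral>x. F x \<partial>M)"
    and "finite K" "S \<subseteq> K" "K \<subseteq> I"
    and h [measurable]: "h \<in> borel_measurable (Pi\<^sub>M I (\<lambda>_. borel))" and h_bound: "\<And>x. \<bar>h x\<bar> \<le> H"
    and h_perm: "\<And>x \<pi>. \<pi> permutes K \<Longrightarrow> h (\<lambda>i\<in>I. x (\<pi> i)) = h x"
    and B: "B \<in> sets (Pi\<^sub>M S (\<lambda>_. borel))"
  shows "(\<integral>x. sampling_weight S x (\<lambda>i. i) * h x * indicator B (restrict x S) \<partial>M)
    = (\<integral>x. sampling_weight S x (\<lambda>i. i) * h x * sample_without_replacement S K B x \<partial>M)"
proof -
  interpret finite_measure M by fact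
  let ?N = "Pi\<^sub>M I (\<lambda>_. borel) :: ('i \<Rightarrow> 'a) measure"
  let ?\<Psi> = "sample_without_replacement S K B"
  let ?b = "\<lambda>x f. indicator B (\<lambda>i\<in>S. x (f i)) :: real"
  have "finite S"
    using \<open>finite K\<close> \<open>S \<subseteq> K\<close> by (rule rev_finite_subset)
  then have fin: "finite (injections S K)"
    using \<open>finite K\<close> by (rule finite_injections)
  have id_inj: "restrict (\<lambda>i. i) S \<in> injections S K"
    using \<open>S \<subseteq> K\<close> by (auto simp: injections_def inj_on_def)
  have card_pos: "real (card (injections S K)) \<noteq> 0"
    using id_inj fin by auto
  have maps: "f \<in> S \<rightarrow> I" if "f \<in> injections S K" for f
    using that \<open>K \<subseteq> I\<close> by (auto simp: injections_def PiE_iff)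
  have id_maps: "(\<lambda>i. i) \<in> S \<rightarrow> I"
    using assms by auto
  have \<Psi>_meas: "?\<Psi> \<in> borel_measurable ?N"
    by (rule measurable_sample_without_replacement[OF \<open>K \<subseteq> I\<close> B])
  have \<Psi>_abs: "\<bar>?\<Psi> x\<bar> \<le> 1" for x
    using sample_without_replacement_bounds[of S K B x] by simp
  have b_meas: "(\<lambda>x. ?b x f) \<in> borel_measurable ?N" if "f \<in> S \<rightarrow> I" for f
    using B by (intro measurable_compose[OF measurable_sampling(2)[OF that] borel_measurable_indicator])
  have integrable: "integrable M (\<lambda>x. sampling_weight S x f * h x * g x)"
    if f: "f \<in> S \<rightarrow> I" and g: "g \<in> borel_measurable ?N" "\<And>x. \<bar>g x\<bar> \<le> 1" for f g
  proof (rule integrable_const_bound)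
    have "\<bar>sampling_weight S x f * h x * g x\<bar> \<le> (\<Prod>i\<in>S. s i) * H * 1" for x
      unfolding abs_mult using sampling_weight_pos[of S x f] sampling_weight_le[of S x f] h_bound[of x] g(2)
      by (intro mult_mono) (auto intro!: mult_nonneg_nonneg order.trans[OF abs_ge_zero h_bound] prod_nonneg
          simp: less_imp_le[OF upper_pos])
    then show "AE x in M. norm (sampling_weight S x f * h x * g x) \<le> (\<Prod>i\<in>S. s i) * H * 1"
      by simp
    have "(\<lambda>x. sampling_weight S x f * h x * g x) \<in> borel_measurable ?N"
      using measurable_sampling(1)[OF f] g(1) by measurable
    then show "(\<lambda>x. sampling_weight S x f * h x * g x) \<in> borel_measurable M"
      by (simp add: measurable_cong_sets[OF sets_M refl])
  qed
  have move: "(\<integral>x. sampling_weight S x (\<lambda>i. i) * h x * indicator B (restrict x S) \<partial>M)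
      = (\<integral>x. sampling_weight S x f * h x * ?b x f \<partial>M)" (is ?move1)
    and move': "(\<integral>x. sampling_weight S x (\<lambda>i. i) * h x * ?\<Psi> x \<partial>M)
      = (\<integral>x. sampling_weight S x f * h x * ?\<Psi> x \<partial>M)" (is ?move2)
    if f: "f \<in> injections S K" for f
  proof -
    obtain \<pi> where \<pi>: "\<pi> permutes K" "\<And>i. i \<in> S \<Longrightarrow> \<pi> i = f i"
      using inj_on_extends_to_permutation[OF \<open>finite K\<close> \<open>S \<subseteq> K\<close>, of f] f
      by (auto simp: injections_def PiE_iff)
    have \<pi>I: "\<pi> permutes I"
      using permutes_subset[OF \<pi>(1) \<open>K \<subseteq> I\<close>] .
    let ?p = "\<lambda>x. \<lambda>i\<in>I. x (\<pi> i)"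
    have SI: "i \<in> I" if "i \<in> S" for i using that assms by auto
    have w: "sampling_weight S (?p x) (\<lambda>i. i) = sampling_weight S x f" for x
      using \<pi>(2) SI by (auto simp: sampling_weight_def intro!: prod.cong)
    have restr: "restrict (?p x) S = (\<lambda>i\<in>S. x (f i))" for x
      using \<pi>(2) SI by (auto simp: fun_eq_iff)
    have \<Psi>: "?\<Psi> (?p x) = ?\<Psi> x" for x
      using \<open>K \<subseteq> I\<close> by (intro sample_without_replacement_permute[OF \<pi>(1)]) auto
    have "(\<lambda>x. sampling_weight S x (\<lambda>i. i) * h x * ?b x (\<lambda>i. i)) \<in> borel_measurable ?N"
      using measurable_sampling(1)[OF id_maps] b_meas[OF id_maps] by measurable
    from perm[OF \<pi>I this, symmetric] show ?move1
      by (simp only: w restr h_perm[OF \<pi>(1)])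
    have "(\<lambda>x. sampling_weight S x (\<lambda>i. i) * h x * ?\<Psi> x) \<in> borel_measurable ?N"
      using measurable_sampling(1)[OF id_maps] \<Psi>_meas by measurable
    from perm[OF \<pi>I this] show ?move2
      by (simp add: w \<Psi> h_perm[OF \<pi>(1)])
  qed
  have "real (card (injections S K)) * (\<integral>x. sampling_weight S x (\<lambda>i. i) * h x * indicator B (restrict x S) \<partial>M)
      = (\<Sum>f\<in>injections S K. \<integral>x. sampling_weight S x f * h x * ?b x f \<partial>M)"
    using sum.cong[OF refl move] by simp
  also have "\<dots> = (\<integral>x. (\<Sum>f\<in>injections S K. sampling_weight S x f * h x * ?b x f) \<partial>M)"
    by (intro Bochner_Integration.integral_sum[symmetric] integrable maps b_meas) auto
  also have "(\<lambda>x. \<Sum>f\<in>injections S K. sampling_weight S x f * h x * ?b x f)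
      = (\<lambda>x. \<Sum>f\<in>injections S K. sampling_weight S x f * h x * ?\<Psi> x)"
  proof
    fix x
    have "0 < (\<Sum>f\<in>injections S K. sampling_weight S x f)"
      using fin id_inj by (intro sum_pos sampling_weight_pos) auto
    then have "(\<Sum>f\<in>injections S K. sampling_weight S x f * ?b x f)
        = (\<Sum>f\<in>injections S K. sampling_weight S x f) * ?\<Psi> x"
      by (simp add: sample_without_replacement_def)
    then have "h x * (\<Sum>f\<in>injections S K. sampling_weight S x f * ?b x f)
        = h x * ((\<Sum>f\<in>injections S K. sampling_weight S x f) * ?\<Psi> x)"
      by simp
    then show "(\<Sum>f\<in>injections S K. sampling_weight S x f * h x * ?b x f)
        = (\<Sum>f\<in>injections S K. sampling_weight S x f * h x * ?\<Psi> x)"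
      by (simp add: sum_distrib_left sum_distrib_right mult_ac)
  qed
  also have "(\<integral>x. (\<Sum>f\<in>injections S K. sampling_weight S x f * h x * ?\<Psi> x) \<partial>M)
      = (\<Sum>f\<in>injections S K. \<integral>x. sampling_weight S x f * h x * ?\<Psi> x \<partial>M)"
    by (intro Bochner_Integration.integral_sum integrable maps \<Psi>_meas \<Psi>_abs)
  also have "\<dots> = real (card (injections S K)) * (\<integral>x. sampling_weight S x (\<lambda>i. i) * h x * ?\<Psi> x \<partial>M)"
    by (simp add: move'[symmetric] cong: sum.cong)
  finally show ?thesis
    by (rule iffD1[OF mult_left_cancel[OF card_pos]])
qed

section \<open>Random pools and the mixing measure\<close>

text \<open>
  The law of \<open>e J x\<close> when \<open>x\<close> is drawn from \<open>P\<close> and then \<open>J\<close> from the weights \<open>w J x\<close>; it is realised as the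
  image of a density on \<open>A \<times> space P\<close>.
\<close>

lemma finite_mixture_exists:
  fixes w :: "'j \<Rightarrow> 'x \<Rightarrow> real" and e :: "'j \<Rightarrow> 'x \<Rightarrow> 'y"
  assumes "prob_space P" "finite A"
    and w: "\<And>J. J \<in> A \<Longrightarrow> w J \<in> borel_measurable P" "\<And>J x. J \<in> A \<Longrightarrow> 0 \<le> w J x"
    and total: "\<And>x. (\<Sum>J\<in>A. w J x) = 1"
    and e: "\<And>J. J \<in> A \<Longrightarrow> e J \<in> P \<rightarrow>\<^sub>M N"
  obtains \<nu> where "prob_space \<nu>" "sets \<nu> = sets N"
    "\<And>g. g \<in> borel_measurable N \<Longrightarrow>
      (\<integral>\<^sup>+y. g y \<partial>\<nu>) = (\<Sum>J\<in>A. \<integral>\<^sup>+x. ennreal (w J x) * g (e J x) \<partial>P)"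
proof -
  interpret prob_space P by fact
  let ?R = "count_space A \<Otimes>\<^sub>M P"
  let ?W = "\<lambda>(J, x). ennreal (w J x)"
  let ?e = "\<lambda>(J, x). e J x"
  let ?\<nu> = "distr (density ?R ?W) N ?e"
  have W: "?W \<in> borel_measurable ?R"
    using w(1) \<open>finite A\<close> by (intro measurable_pair_measure_countable1) (auto intro: countable_finite)
  have e': "?e \<in> ?R \<rightarrow>\<^sub>M N"
    using e \<open>finite A\<close> by (intro measurable_pair_measure_countable1) (auto intro: countable_finite)
  have integral: "(\<integral>\<^sup>+y. g y \<partial>?\<nu>) = (\<Sum>J\<in>A. \<integral>\<^sup>+x. ennreal (w J x) * g (e J x) \<partial>P)"
    if g: "g \<in> borel_measurable N" for g
  proof -
    have ge: "(\<lambda>z. g (?e z)) \<in> borel_measurable ?R"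
      using measurable_compose[OF e' g] .
    have "(\<integral>\<^sup>+y. g y \<partial>?\<nu>) = (\<integral>\<^sup>+z. g (?e z) \<partial>density ?R ?W)"
      using e' g by (intro nn_integral_distr) simp_all
    also have "\<dots> = (\<integral>\<^sup>+z. ?W z * g (?e z) \<partial>?R)"
      using W ge by (intro nn_integral_density) auto
    also have "\<dots> = (\<integral>\<^sup>+J. \<integral>\<^sup>+x. ?W (J, x) * g (?e (J, x)) \<partial>P \<partial>count_space A)"
      using W ge by (intro nn_integral_fst[symmetric] borel_measurable_times_ennreal)
    finally show ?thesis
      using \<open>finite A\<close> by (simp add: nn_integral_count_space_finite)
  qed
  have "emeasure ?\<nu> (space ?\<nu>) = (\<integral>\<^sup>+y. 1 \<partial>?\<nu>)"
    by simp
  also have "\<dots> = (\<Sum>J\<in>A. \<integral>\<^sup>+x. ennreal (w J x) \<partial>P)"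
    using integral[of "\<lambda>_. 1"] by simp
  also have "\<dots> = (\<integral>\<^sup>+x. (\<Sum>J\<in>A. ennreal (w J x)) \<partial>P)"
    using w(1) by (intro nn_integral_sum[symmetric]) auto
  also have "\<dots> = (\<integral>\<^sup>+x. 1 \<partial>P)"
    using w(2) total by (simp add: sum_ennreal)
  also have "\<dots> = 1"
    by (simp add: emeasure_space_1)
  finally have "prob_space ?\<nu>"
    by (rule prob_spaceI)
  then show thesis
    using that integral by simp
qed

locale weighted_exchangeable_law = bounded_weights l c s
  for l :: "nat \<Rightarrow> 'a::polish_space \<Rightarrow> real" and c s :: "nat \<Rightarrow> real" +
  fixes P :: "(nat \<Rightarrow> 'a) measure" and n k :: nat
  assumes weighted_exchangeable: "weighted_exchangeable n l P"
    and k: "1 \<le> k" "k \<le> n"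
begin

definition keep_prob :: "(nat \<Rightarrow> 'a) \<Rightarrow> nat \<Rightarrow> real" where
  "keep_prob x i = c i / l i (x i)"

text \<open>
  The conditional probability, given \<open>x\<close>, that exactly the indices in \<open>J\<close> are kept when every \<open>i > k\<close> is
  kept independently with probability \<open>keep_prob x i\<close>.
\<close>

definition kept_prob :: "nat set \<Rightarrow> (nat \<Rightarrow> 'a) \<Rightarrow> real" where
  "kept_prob J x = (\<Prod>i\<in>J. keep_prob x i) * (\<Prod>i\<in>{k+1..n} - J. 1 - keep_prob x i)"

lemma prob_space_P: "prob_space P" and sets_P: "sets P = sets (seq_space n)"
  using weighted_exchangeable by (auto simp: weighted_exchangeable_def)

lemma keep_prob_bounds: "c i / s i \<le> keep_prob x i" "0 < keep_prob x i" "keep_prob x i \<le> 1"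
  using lower[of i "x i"] upper[of i "x i"] weight_pos[of i "x i"] lower_pos[of i]
  by (auto simp: keep_prob_def intro!: divide_left_mono)

lemma measurable_weight_component:
  "i \<in> {1..n} \<Longrightarrow> (\<lambda>x. l i (x i)) \<in> borel_measurable (seq_space n)"
  by (intro measurable_compose[OF _ measurable_weight] measurable_component_singleton)

lemma measurable_kept_prob:
  assumes "J \<subseteq> {k+1..n}"
  shows "kept_prob J \<in> borel_measurable (seq_space n)"
  unfolding kept_prob_def[abs_def] keep_prob_def using assms
  by (intro borel_measurable_times borel_measurable_prod borel_measurable_diff borel_measurable_divide
      borel_measurable_const measurable_weight_component) auto

lemma kept_prob_nonneg: "0 \<le> kept_prob J x"
  unfolding kept_prob_def using keep_prob_bounds
  by (intro mult_nonneg_nonneg prod_nonneg) (auto simp: less_imp_le)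

lemma sum_kept_prob: "(\<Sum>J\<in>Pow {k+1..n}. kept_prob J x) = 1"
  unfolding kept_prob_def by (subst prod_add[symmetric]) simp_all

lemma kept_prob_le_1:
  assumes "J \<subseteq> {k+1..n}"
  shows "kept_prob J x \<le> 1"
proof -
  have "kept_prob J x \<le> (\<Sum>J\<in>Pow {k+1..n}. kept_prob J x)"
    using assms by (intro member_le_sum) (auto simp: kept_prob_nonneg)
  then show ?thesis by (simp only: sum_kept_prob)
qed

lemma integrable_kept_prob:
  assumes "J \<subseteq> {k+1..n}" "g \<in> borel_measurable (seq_space n)" "\<And>x. \<bar>g x\<bar> \<le> 1"
  shows "integrable P (\<lambda>x. kept_prob J x * g x)"
proof -
  interpret prob_space P by (rule prob_space_P)
  show ?thesis
  proof (rule integrable_const_bound[where B = 1])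
    have "\<bar>kept_prob J x * g x\<bar> \<le> 1 * 1" for x
      unfolding abs_mult using kept_prob_nonneg[of J x] kept_prob_le_1[OF assms(1), of x] assms(3)[of x]
      by (intro mult_mono) auto
    then show "AE x in P. norm (kept_prob J x * g x) \<le> 1"
      by simp
    show "(\<lambda>x. kept_prob J x * g x) \<in> borel_measurable P"
      unfolding measurable_cong_sets[OF sets_P refl]
      using measurable_kept_prob[OF assms(1)] assms(2) by (intro borel_measurable_times)
  qed
qed

text \<open>
  Multiplying the density of \<open>P\<close> by \<open>kept_prob J\<close> replaces the weight of every coordinate \<open>i > k\<close> by \<open>c i\<close> or
  \<open>l i (x i) - c i\<close>, according to whether \<open>i \<in> J\<close>. What multiplies the weights of the first \<open>k\<close>
  coordinates then does not depend on the pool, and the first \<open>k\<close> coordinates become a sample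
  without replacement from it.
\<close>

lemma integral_kept:
  assumes J: "J \<subseteq> {k+1..n}" and B: "B \<in> sets (seq_space k)"
  shows "(\<integral>x. kept_prob J x * indicator B (restrict x {1..k}) \<partial>P)
    = (\<integral>x. kept_prob J x * sample_without_replacement {1..k} ({1..k} \<union> J) B x \<partial>P)"
proof -
  let ?L = "\<lambda>x. \<Prod>i\<in>{1..n}. l i (x i)"
  let ?M = "density P (\<lambda>x. ennreal (1 / ?L x))"
  let ?K = "{1..k} \<union> J"
  let ?h = "\<lambda>x. (\<Prod>i\<in>J. c i) * (\<Prod>i\<in>{k+1..n} - J. l i (x i) - c i)"
  interpret M: prob_space ?M
    using weighted_exchangeable by (simp add: weighted_exchangeable_def Let_def)
  have exch: "exchangeable n ?M"
    using weighted_exchangeable by (simp add: weighted_exchangeable_def Let_def)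
  have sets_M: "sets ?M = sets (seq_space n)"
    by (simp add: sets_P)
  have L_pos: "0 < ?L x" for x
    by (intro prod_pos weight_pos)
  have L_meas: "?L \<in> borel_measurable (seq_space n)"
    by (intro borel_measurable_prod measurable_weight_component)
  have "density ?M (\<lambda>x. ennreal (?L x)) = density P (\<lambda>x. ennreal (1 / ?L x) * ennreal (?L x))"
    using L_meas by (intro density_density_eq) (auto simp: measurable_cong_sets[OF sets_P refl])
  also have "\<dots> = density P (\<lambda>_. 1)"
    using L_pos by (intro arg_cong[of _ _ "density P"])
      (auto simp: ennreal_mult[symmetric] less_imp_le less_imp_neq[symmetric])
  finally have P: "P = density ?M (\<lambda>x. ennreal (?L x))"
    by (simp add: density_1)
  have h_meas: "?h \<in> borel_measurable (seq_space n)"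
    by (intro borel_measurable_times borel_measurable_prod borel_measurable_diff
        borel_measurable_const measurable_weight_component) auto
  have factor: "?L x * kept_prob J x = sampling_weight {1..k} x (\<lambda>i. i) * ?h x" for x
  proof -
    have split: "{1..n} = {1..k} \<union> {k+1..n}"
      using k by auto
    have "?L x = (\<Prod>i\<in>{1..k}. l i (x i)) * (\<Prod>i\<in>{k+1..n}. l i (x i))"
      unfolding split by (rule prod.union_disjoint) auto
    also have "(\<Prod>i\<in>{k+1..n}. l i (x i)) = (\<Prod>i\<in>{k+1..n} - J. l i (x i)) * (\<Prod>i\<in>J. l i (x i))"
      using J by (intro prod.subset_diff) auto
    finally have "?L x * kept_prob J x = (\<Prod>i\<in>{1..k}. l i (x i)) *
        ((\<Prod>i\<in>J. l i (x i) * keep_prob x i) * (\<Prod>i\<in>{k+1..n} - J. l i (x i) * (1 - keep_prob x i)))"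
      by (simp add: kept_prob_def prod.distrib mult_ac)
    also have "(\<Prod>i\<in>J. l i (x i) * keep_prob x i) = (\<Prod>i\<in>J. c i)"
      using weight_pos by (intro prod.cong) (auto simp: keep_prob_def less_imp_neq[symmetric])
    also have "(\<Prod>i\<in>{k+1..n} - J. l i (x i) * (1 - keep_prob x i)) = (\<Prod>i\<in>{k+1..n} - J. l i (x i) - c i)"
      using weight_pos by (intro prod.cong) (auto simp: keep_prob_def right_diff_distrib less_imp_neq[symmetric])
    finally show ?thesis by (simp add: sampling_weight_def)
  qed
  have change: "(\<integral>x. kept_prob J x * g x \<partial>P) = (\<integral>x. sampling_weight {1..k} x (\<lambda>i. i) * ?h x * g x \<partial>?M)"
    if g: "g \<in> borel_measurable (seq_space n)" for g
  proof -
    have "(\<integral>x. kept_prob J x * g x \<partial>P) = (\<integral>x. kept_prob J x * g x \<partial>density ?M (\<lambda>x. ennreal (?L x)))"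
      by (subst P) simp
    also have "\<dots> = (\<integral>x. ?L x *\<^sub>R (kept_prob J x * g x) \<partial>?M)"
    proof (rule integral_density)
      show "(\<lambda>x. kept_prob J x * g x) \<in> borel_measurable ?M" "?L \<in> borel_measurable ?M"
        unfolding measurable_cong_sets[OF sets_M refl]
        by (intro borel_measurable_times measurable_kept_prob[OF J] g L_meas)+
      show "AE x in ?M. 0 \<le> ?L x"
        by (rule AE_I2) (rule less_imp_le[OF L_pos])
    qed
    also have "\<dots> = (\<integral>x. (?L x * kept_prob J x) * g x \<partial>?M)"
      by (simp add: mult.assoc)
    finally show ?thesis by (simp only: factor)
  qed
  have "(\<integral>x. sampling_weight {1..k} x (\<lambda>i. i) * ?h x * indicator B (restrict x {1..k}) \<partial>?M)
    = (\<integral>x. sampling_weight {1..k} x (\<lambda>i. i) * ?h x * sample_without_replacement {1..k} ?K B x \<partial>?M)"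
  proof (rule integral_sample_without_replacement[where I = "{1..n}"
        and H = "(\<Prod>i\<in>J. c i) * (\<Prod>i\<in>{k+1..n} - J. s i)"])
    show "(\<integral>x. F (\<lambda>i\<in>{1..n}. x (\<pi> i)) \<partial>?M) = (\<integral>x. F x \<partial>?M)"
      if "\<pi> permutes {1..n}" "F \<in> borel_measurable (seq_space n)" for \<pi> and F :: "(nat \<Rightarrow> 'a) \<Rightarrow> real"
      by (rule integral_permute_exchangeable[OF exch sets_M that])
    show "finite ?K" "{1..k} \<subseteq> ?K" "?K \<subseteq> {1..n}"
      using J k by (auto intro: finite_subset)
    show "\<bar>?h x\<bar> \<le> (\<Prod>i\<in>J. c i) * (\<Prod>i\<in>{k+1..n} - J. s i)" for x
    proof -
      have "0 \<le> l i y - c i" "l i y - c i \<le> s i" for i y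
        using lower[of i y] upper[of i y] lower_pos[of i] by linarith+
      then have "0 \<le> (\<Prod>i\<in>{k+1..n} - J. l i (x i) - c i)"
        "(\<Prod>i\<in>{k+1..n} - J. l i (x i) - c i) \<le> (\<Prod>i\<in>{k+1..n} - J. s i)"
        by (auto intro!: prod_nonneg prod_mono)
      moreover have "0 < (\<Prod>i\<in>J. c i)"
        by (intro prod_pos lower_pos)
      ultimately show ?thesis by (simp add: abs_mult)
    qed
    show "?h (\<lambda>i\<in>{1..n}. x (\<pi> i)) = ?h x" if "\<pi> permutes ?K" for x \<pi>
    proof -
      have fixed: "(\<lambda>i\<in>{1..n}. x (\<pi> i)) i = x i" if "i \<in> {k+1..n} - J" for i
        using permutes_not_in[OF \<open>\<pi> permutes ?K\<close>, of i] that by auto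
      have "(\<Prod>i\<in>{k+1..n} - J. l i ((\<lambda>i\<in>{1..n}. x (\<pi> i)) i) - c i)
          = (\<Prod>i\<in>{k+1..n} - J. l i (x i) - c i)"
        by (rule prod.cong[OF refl]) (simp only: fixed)
      then show ?thesis by (simp only:)
    qed
  qed (use M.finite_measure_axioms sets_M h_meas B in auto)
  moreover have "(\<lambda>x. indicator B (restrict x {1..k}) :: real) \<in> borel_measurable (seq_space n)"
    using B k by (intro measurable_compose[OF _ borel_measurable_indicator] measurable_restrict_subset) auto
  moreover have "sample_without_replacement {1..k} ?K B \<in> borel_measurable (seq_space n)"
    using J B k by (intro measurable_sample_without_replacement) auto
  ultimately show ?thesis
    by (simp only: change)
qed


abbreviation pool :: "nat set \<Rightarrow> nat set" where
  "pool J \<equiv> {1..k} \<union> J"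

definition with_replacement :: "nat set \<Rightarrow> (nat \<Rightarrow> 'a) set \<Rightarrow> (nat \<Rightarrow> 'a) \<Rightarrow> real" where
  "with_replacement J B x = measure (Pi\<^sub>M {1..k} (\<lambda>i. tilt (l i) (empirical (pool J) x))) B"

lemma pool:
  assumes "J \<subseteq> {k+1..n}"
  shows "finite (pool J)" "pool J \<noteq> {}" "pool J \<subseteq> {1..n}" "card (pool J) = k + card J"
proof -
  have "finite J" using assms by (auto intro: finite_subset)
  moreover have "{1..k} \<inter> J = {}" using assms by auto
  ultimately show "card (pool J) = k + card J" by (subst card_Un_disjoint) auto
qed (use assms k in \<open>auto intro: finite_subset\<close>)

lemma measurable_with_replacement:
  assumes "J \<subseteq> {k+1..n}" "B \<in> sets (seq_space k)"
  shows "with_replacement J B \<in> borel_measurable (seq_space n)"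
proof -
  have "(\<lambda>x. Pi\<^sub>M {1..k} (\<lambda>i. tilt (l i) (empirical (pool J) x))) \<in> seq_space n \<rightarrow>\<^sub>M prob_algebra (seq_space k)"
    by (rule measurable_compose[OF measurable_empirical[OF pool(1,2)[OF assms(1)]]
          measurable_PiM_tilt[OF _ weak_borel_measurable_prob_algebra]]) simp
  from measurable_compose[OF measurable_prob_algebraD[OF this] measurable_measure_subprob_algebra[OF assms(2)]]
  show ?thesis by (simp add: with_replacement_def[abs_def])
qed

lemma with_replacement_bounds: "0 \<le> with_replacement J B x" "with_replacement J B x \<le> 1"
  using prob_space.prob_le_1[OF prob_space_PiM_tilt[OF empirical_in_space_prob_algebra]]
  by (simp_all add: with_replacement_def)

lemma emeasure_PiM_tilt_restrict:
  assumes "\<mu> \<in> space (prob_algebra borel)" "B \<in> sets (seq_space k)"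
  shows "emeasure (Pi\<^sub>M {1..n} (\<lambda>i. tilt (l i) \<mu>)) (prod_emb {1..n} (\<lambda>_. borel) {1..k} B)
    = emeasure (Pi\<^sub>M {1..k} (\<lambda>i. tilt (l i) \<mu>)) B"
proof -
  interpret product_prob_space "\<lambda>i. tilt (l i) \<mu>"
    by (rule product_prob_space_tilt) fact
  have "prod_emb {1..n} (\<lambda>_. borel) {1..k} B = prod_emb {1..n} (\<lambda>i. tilt (l i) \<mu>) {1..k} B"
    using in_space_prob_algebraD(3)[OF assms(1)] by (simp add: prod_emb_def)
  then show ?thesis
    using emeasure_prod_emb[of "{1..k}" "{1..n}" B] assms k
    by (simp add: sets_PiM_tilt)
qed

text \<open>
  Mixing over the law of the empirical measure of the random pool gives, for every event of the
  first \<open>k\<close> coordinates, the mean probability of that event under sampling with replacement from the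
  pool. The remaining coordinates integrate out of each product measure.
\<close>

lemma pool_mixture_exists:
  obtains Q where "weighted_iid_mixture n l Q"
    "\<And>B. B \<in> sets (seq_space k) \<Longrightarrow> measure (marginal k Q) B
      = (\<Sum>J\<in>Pow {k+1..n}. \<integral>x. kept_prob J x * with_replacement J B x \<partial>P)"
proof -
  let ?kernel = "\<lambda>\<mu>. Pi\<^sub>M {1..n} (\<lambda>i. tilt (l i) \<mu>)"
  note P_cong = measurable_cong_sets[OF sets_P refl]
  \<comment> \<open>The mixing measure is the law of the empirical measure of the random pool.\<close>
  obtain \<nu> where \<nu>: "prob_space \<nu>" "sets \<nu> = sets (weak_borel :: 'a measure measure)"
    and \<nu>_integral: "\<And>g. g \<in> borel_measurable weak_borel \<Longrightarrow>
      (\<integral>\<^sup>+\<mu>. g \<mu> \<partial>\<nu>) = (\<Sum>J\<in>Pow {k+1..n}. \<integral>\<^sup>+x. ennreal (kept_prob J x) * g (empirical (pool J) x) \<partial>P)"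
  proof (rule finite_mixture_exists[of P "Pow {k+1..n}" kept_prob "\<lambda>J. empirical (pool J)" weak_borel])
    show "kept_prob J \<in> borel_measurable P" if "J \<in> Pow {k+1..n}" for J
      using measurable_kept_prob that unfolding P_cong by auto
    show "empirical (pool J) \<in> P \<rightarrow>\<^sub>M weak_borel" if "J \<in> Pow {k+1..n}" for J
      unfolding P_cong using pool that by (intro measurable_empirical) auto
  qed (auto simp: prob_space_P kept_prob_nonneg sum_kept_prob[simplified])
  have space_\<nu>: "space \<nu> = space (prob_algebra borel)"
    using sets_eq_imp_space_eq[OF \<nu>(2)] by (simp add: space_weak_borel)
  have kernel: "?kernel \<in> weak_borel \<rightarrow>\<^sub>M prob_algebra (seq_space n)"
    by (intro measurable_PiM_tilt weak_borel_measurable_prob_algebra) simp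
  then have kernel_\<nu>: "?kernel \<in> \<nu> \<rightarrow>\<^sub>M subprob_algebra (seq_space n)"
    unfolding measurable_cong_sets[OF \<nu>(2) refl] by (rule measurable_prob_algebraD)
  have nonempty: "space \<nu> \<noteq> {}"
    using \<nu>(1) by (rule prob_space.not_empty)
  define Q where "Q = \<nu> \<bind> ?kernel"
  have sets_Q: "sets Q = sets (seq_space n)"
    unfolding Q_def by (rule sets_bind[OF sets_kernel[OF kernel_\<nu>] nonempty])
  have emeasure_Q: "emeasure Q B = (\<integral>\<^sup>+\<mu>. emeasure (?kernel \<mu>) B \<partial>\<nu>)" if "B \<in> sets (seq_space n)" for B
    unfolding Q_def by (rule emeasure_bind[OF nonempty kernel_\<nu> that])
  have "weighted_iid_mixture n l Q"
    unfolding weighted_iid_mixture_def using sets_Q emeasure_Q \<nu>(1,2) by blast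
  moreover have "measure (marginal k Q) B
      = (\<Sum>J\<in>Pow {k+1..n}. \<integral>x. kept_prob J x * with_replacement J B x \<partial>P)"
    if B: "B \<in> sets (seq_space k)" for B
  proof -
    let ?E = "prod_emb {1..n} (\<lambda>_. borel) {1..k} B :: (nat \<Rightarrow> 'a) set"
    have sub: "{1..k} \<subseteq> {1..n}" using k by auto
    have E: "?E \<in> sets (seq_space n)"
      using sub B by (intro measurable_prod_emb) auto
    have "emeasure (marginal k Q) B = emeasure Q ?E"
      unfolding marginal_def using sub sets_Q B by (rule emeasure_distr_restrict)
    also have "\<dots> = (\<integral>\<^sup>+\<mu>. emeasure (?kernel \<mu>) ?E \<partial>\<nu>)"
      by (rule emeasure_Q[OF E])
    also have "\<dots> = (\<Sum>J\<in>Pow {k+1..n}. \<integral>\<^sup>+x. ennreal (kept_prob J x) * emeasure (?kernel (empirical (pool J) x)) ?E \<partial>P)"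
      by (rule \<nu>_integral)
         (rule measurable_compose[OF measurable_prob_algebraD[OF kernel] measurable_emeasure_subprob_algebra[OF E]])
    also have "\<dots> = (\<Sum>J\<in>Pow {k+1..n}. ennreal (\<integral>x. kept_prob J x * with_replacement J B x \<partial>P))"
    proof (rule sum.cong)
      fix J assume "J \<in> Pow {k+1..n}"
      then have J: "J \<subseteq> {k+1..n}" by simp
      have "emeasure (?kernel (empirical (pool J) x)) ?E = ennreal (with_replacement J B x)" for x
        unfolding emeasure_PiM_tilt_restrict[OF empirical_in_space_prob_algebra B] with_replacement_def
        by (intro finite_measure.emeasure_eq_measure prob_space.finite_measure prob_space_PiM_tilt
            empirical_in_space_prob_algebra)
      then have "(\<integral>\<^sup>+x. ennreal (kept_prob J x) * emeasure (?kernel (empirical (pool J) x)) ?E \<partial>P)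
          = (\<integral>\<^sup>+x. ennreal (kept_prob J x * with_replacement J B x) \<partial>P)"
        by (simp add: ennreal_mult kept_prob_nonneg with_replacement_bounds)
      also have "\<dots> = ennreal (\<integral>x. kept_prob J x * with_replacement J B x \<partial>P)"
        using with_replacement_bounds[of J B]
        by (intro nn_integral_eq_integral integrable_kept_prob J measurable_with_replacement B)
           (auto intro!: mult_nonneg_nonneg kept_prob_nonneg)
      finally show "(\<integral>\<^sup>+x. ennreal (kept_prob J x) * emeasure (?kernel (empirical (pool J) x)) ?E \<partial>P)
          = ennreal (\<integral>x. kept_prob J x * with_replacement J B x \<partial>P)" .
    qed simp
    also have "\<dots> = ennreal (\<Sum>J\<in>Pow {k+1..n}. \<integral>x. kept_prob J x * with_replacement J B x \<partial>P)"
      by (intro sum_ennreal Bochner_Integration.integral_nonneg mult_nonneg_nonneg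
          kept_prob_nonneg with_replacement_bounds)
    finally show ?thesis
      by (simp add: measure_def sum_nonneg Bochner_Integration.integral_nonneg kept_prob_nonneg
          with_replacement_bounds)
  qed
  ultimately show thesis by (rule that)
qed

text \<open>
  The counterpart for \<open>P\<close>: split the event according to the random pool, using that the
  probabilities of the pools add up to 1, and apply \<open>integral_kept\<close> to each of them.
\<close>

lemma measure_marginal:
  assumes B: "B \<in> sets (seq_space k)"
  shows "measure (marginal k P) B
    = (\<Sum>J\<in>Pow {k+1..n}. \<integral>x. kept_prob J x * sample_without_replacement {1..k} (pool J) B x \<partial>P)"
proof -
  interpret prob_space P by (rule prob_space_P)
  have sub: "{1..k} \<subseteq> {1..n}" using k by auto
  let ?E = "(\<lambda>x. restrict x {1..k}) -` B \<inter> space P"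
  have restr: "(\<lambda>x. restrict x {1..k}) \<in> seq_space n \<rightarrow>\<^sub>M (seq_space k :: (nat \<Rightarrow> 'a) measure)"
    using sub by (rule measurable_restrict_subset)
  then have restr_P: "(\<lambda>x. restrict x {1..k}) \<in> P \<rightarrow>\<^sub>M seq_space k"
    unfolding measurable_cong_sets[OF sets_P refl] .
  let ?b = "\<lambda>x. indicator B (restrict x {1..k}) :: real"
  have b_meas: "?b \<in> borel_measurable (seq_space n)"
    using B by (intro measurable_compose[OF restr borel_measurable_indicator])
  have "measure (marginal k P) B = measure P ?E"
    unfolding marginal_def using restr_P B by (rule measure_distr)
  also have "\<dots> = (\<integral>x. indicator ?E x \<partial>P)"
    using measurable_sets[OF restr_P B] by simp
  also have "\<dots> = (\<integral>x. (\<Sum>J\<in>Pow {k+1..n}. kept_prob J x * ?b x) \<partial>P)"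
    by (intro Bochner_Integration.integral_cong)
       (auto simp: sum_distrib_right[symmetric] sum_kept_prob[simplified] indicator_def)
  also have "\<dots> = (\<Sum>J\<in>Pow {k+1..n}. \<integral>x. kept_prob J x * ?b x \<partial>P)"
    using b_meas by (intro Bochner_Integration.integral_sum integrable_kept_prob) auto
  also have "\<dots> = (\<Sum>J\<in>Pow {k+1..n}. \<integral>x. kept_prob J x * sample_without_replacement {1..k} (pool J) B x \<partial>P)"
    using B by (intro sum.cong integral_kept) auto
  finally show ?thesis .
qed

lemma expected_inverse_Suc_card_kept_le:
  "(\<Sum>J\<in>Pow {k+1..n}. (\<integral>x. kept_prob J x \<partial>P) / (1 + real (card J)))
    \<le> (if (\<Sum>i\<in>{k+1..n}. c i / s i) = 0 then 1
       else (1 - exp (- (\<Sum>i\<in>{k+1..n}. c i / s i))) / (\<Sum>i\<in>{k+1..n}. c i / s i))"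
proof -
  interpret prob_space P by (rule prob_space_P)
  let ?F = "if (\<Sum>i\<in>{k+1..n}. c i / s i) = 0 then 1
       else (1 - exp (- (\<Sum>i\<in>{k+1..n}. c i / s i))) / (\<Sum>i\<in>{k+1..n}. c i / s i)"
  have int: "integrable P (\<lambda>x. kept_prob J x)" if "J \<in> Pow {k+1..n}" for J
    using integrable_kept_prob[of J "\<lambda>_. 1"] that by simp
  have "(\<Sum>J\<in>Pow {k+1..n}. (\<integral>x. kept_prob J x \<partial>P) / (1 + real (card J)))
      = (\<integral>x. (\<Sum>J\<in>Pow {k+1..n}. kept_prob J x / (1 + real (card J))) \<partial>P)"
    using int by (subst Bochner_Integration.integral_sum) auto
  also have "\<dots> \<le> (\<integral>x. ?F \<partial>P)"
  proof (rule integral_mono)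
    fix x
    show "(\<Sum>J\<in>Pow {k+1..n}. kept_prob J x / (1 + real (card J))) \<le> ?F"
      unfolding kept_prob_def
      by (rule expected_inverse_Suc_count_le)
         (auto simp: keep_prob_bounds less_imp_le[OF lower_pos] less_imp_le[OF upper_pos])
  qed (use int in \<open>auto intro!: Bochner_Integration.integrable_sum\<close>)
  also have "\<dots> = ?F"
    by (simp add: prob_space)
  finally show ?thesis .
qed

text \<open>
  Both marginals are averages over the same random pool, one of sampling without and the other of
  sampling with replacement, so the pointwise collision bound may be averaged.
\<close>

lemma pool_mixture_close:
  assumes r: "0 < r" "\<And>i. i \<in> {1..k} \<Longrightarrow> r \<le> c i / s i"
  obtains Q where "weighted_iid_mixture n l Q"
    "\<And>B. B \<in> sets (seq_space k) \<Longrightarrow> \<bar>measure (marginal k P) B - measure (marginal k Q) B\<bar>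
      \<le> real k * (real k - 1) / (2 * r) *
        (if (\<Sum>i\<in>{k+1..n}. c i / s i) = 0 then 1
         else (1 - exp (- (\<Sum>i\<in>{k+1..n}. c i / s i))) / (\<Sum>i\<in>{k+1..n}. c i / s i))"
proof -
  obtain Q where Q: "weighted_iid_mixture n l Q"
    "\<And>B. B \<in> sets (seq_space k) \<Longrightarrow> measure (marginal k Q) B
      = (\<Sum>J\<in>Pow {k+1..n}. \<integral>x. kept_prob J x * with_replacement J B x \<partial>P)"
    using pool_mixture_exists by blast
  let ?C = "real k * (real k - 1) / (2 * r)"
  have C: "0 \<le> ?C" using k r by simp
  show thesis
  proof (rule that[OF Q(1)])
    fix B :: "(nat \<Rightarrow> 'a) set" assume B: "B \<in> sets (seq_space k)"
    have close: "\<bar>(\<integral>x. kept_prob J x * sample_without_replacement {1..k} (pool J) B x \<partial>P)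
        - (\<integral>x. kept_prob J x * with_replacement J B x \<partial>P)\<bar>
        \<le> ?C * ((\<integral>x. kept_prob J x \<partial>P) / (1 + real (card J)))" if "J \<in> Pow {k+1..n}" for J
    proof -
      have J: "J \<subseteq> {k+1..n}" using that by simp
      let ?\<Psi> = "sample_without_replacement {1..k} (pool J) B" and ?\<Phi> = "with_replacement J B"
      let ?e = "?C / (1 + real (card J))"
      have id_inj: "restrict (\<lambda>i. i) {1..k} \<in> injections {1..k} (pool J)"
        by (auto simp: injections_def inj_on_def)
      have pointwise: "\<bar>?\<Psi> x - ?\<Phi> x\<bar> \<le> ?e" for x
      proof -
        have "\<bar>?\<Psi> x - ?\<Phi> x\<bar> \<le> real (card {1..k}) * (real (card {1..k}) - 1) / (2 * r) / real (card (pool J))"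
          unfolding with_replacement_def
          by (rule sample_without_replacement_close)
             (use pool[OF J] B r id_inj in auto)
        also have "\<dots> = ?C / (real k + real (card J))"
          using pool(4)[OF J] by simp
        \<comment> \<open>Weaken \<open>k + card J\<close> to \<open>1 + card J\<close>, the form whose mean is computed above.\<close>
        also have "\<dots> \<le> ?e"
          using k by (intro divide_left_mono C) auto
        finally show ?thesis .
      qed
      have \<Psi>_int: "integrable P (\<lambda>x. kept_prob J x * ?\<Psi> x)"
        using sample_without_replacement_bounds[of "{1..k}" "pool J" B] pool(3)[OF J] B
        by (intro integrable_kept_prob J measurable_sample_without_replacement) (auto simp: abs_le_iff intro: order.trans[of _ 0])
      have \<Phi>_int: "integrable P (\<lambda>x. kept_prob J x * ?\<Phi> x)"
        using with_replacement_bounds[of J B]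
        by (intro integrable_kept_prob J measurable_with_replacement B) (auto simp: abs_le_iff intro: order.trans[of _ 0])
      have w_int: "integrable P (\<lambda>x. kept_prob J x)"
        using integrable_kept_prob[OF J, of "\<lambda>_. 1"] by simp
      have "\<bar>(\<integral>x. kept_prob J x * ?\<Psi> x \<partial>P) - (\<integral>x. kept_prob J x * ?\<Phi> x \<partial>P)\<bar>
          = \<bar>\<integral>x. kept_prob J x * ?\<Psi> x - kept_prob J x * ?\<Phi> x \<partial>P\<bar>"
        using \<Psi>_int \<Phi>_int by simp
      also have "\<dots> \<le> (\<integral>x. \<bar>kept_prob J x * ?\<Psi> x - kept_prob J x * ?\<Phi> x\<bar> \<partial>P)"
        by (rule integral_abs_bound)
      also have "\<dots> \<le> (\<integral>x. kept_prob J x * ?e \<partial>P)"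
      proof (rule integral_mono)
        fix x
        have "\<bar>kept_prob J x * ?\<Psi> x - kept_prob J x * ?\<Phi> x\<bar> = kept_prob J x * \<bar>?\<Psi> x - ?\<Phi> x\<bar>"
          using kept_prob_nonneg[of J x] by (simp add: right_diff_distrib[symmetric] abs_mult)
        also have "\<dots> \<le> kept_prob J x * ?e"
          by (intro mult_left_mono pointwise kept_prob_nonneg)
        finally show "\<bar>kept_prob J x * ?\<Psi> x - kept_prob J x * ?\<Phi> x\<bar> \<le> kept_prob J x * ?e" .
      qed (use \<Psi>_int \<Phi>_int w_int in auto)
      also have "\<dots> = ?C * ((\<integral>x. kept_prob J x \<partial>P) / (1 + real (card J)))"
        by simp
      finally show ?thesis .
    qed
    have "\<bar>measure (marginal k P) B - measure (marginal k Q) B\<bar>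
        = \<bar>\<Sum>J\<in>Pow {k+1..n}. (\<integral>x. kept_prob J x * sample_without_replacement {1..k} (pool J) B x \<partial>P)
            - (\<integral>x. kept_prob J x * with_replacement J B x \<partial>P)\<bar>"
      unfolding measure_marginal[OF B] Q(2)[OF B] sum_subtractf ..
    also have "\<dots> \<le> (\<Sum>J\<in>Pow {k+1..n}. ?C * ((\<integral>x. kept_prob J x \<partial>P) / (1 + real (card J))))"
      by (intro order.trans[OF sum_abs] sum_mono close)
    also have "\<dots> = ?C * (\<Sum>J\<in>Pow {k+1..n}. (\<integral>x. kept_prob J x \<partial>P) / (1 + real (card J)))"
      by (rule sum_distrib_left[symmetric])
    also have "\<dots> \<le> ?C * (if (\<Sum>i\<in>{k+1..n}. c i / s i) = 0 then 1
         else (1 - exp (- (\<Sum>i\<in>{k+1..n}. c i / s i))) / (\<Sum>i\<in>{k+1..n}. c i / s i))"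
      using C expected_inverse_Suc_card_kept_le by (intro mult_left_mono)
    finally show "\<bar>measure (marginal k P) B - measure (marginal k Q) B\<bar> \<le> \<dots>" .
  qed
qed

end

section \<open>The finite de Finetti bound\<close>

theorem theorem4p1:
  fixes l :: "nat \<Rightarrow> 'a::polish_space \<Rightarrow> real"
    and P :: "(nat \<Rightarrow> 'a) measure"
    and n k :: nat
  assumes "1 \<le> n"
    and "\<And>i. i \<in> {1..n} \<Longrightarrow> l i \<in> weights"
    and "weighted_exchangeable n l P"
    and "1 \<le> k" and "k \<le> n"
    and "\<And>i. i \<in> {1..n} \<Longrightarrow> weight_ratio (l i) > 0"
  shows "\<exists>Q. weighted_iid_mixture n l Q \<and>
    tv_dist (marginal k P) (marginal k Q)
      \<le> real k * (real k - 1) / (2 * (MIN i\<in>{1..k}. weight_ratio (l i))) *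
         (if k = n then 1
          else (1 - exp (- (\<Sum>i\<in>{k+1..n}. weight_ratio (l i)))) /
               (\<Sum>i\<in>{k+1..n}. weight_ratio (l i)))"
proof -
  have "\<forall>i. \<exists>c s. i \<in> {1..n} \<longrightarrow>
      0 < c \<and> (\<forall>y. c \<le> l i y) \<and> (\<forall>y. l i y \<le> s) \<and> weight_ratio (l i) = c / s"
    using weight_ratio_pos_bounds assms(2,6) by metis
  then obtain c s where cs: "\<And>i. i \<in> {1..n} \<Longrightarrow>
      0 < c i \<and> (\<forall>y. c i \<le> l i y) \<and> (\<forall>y. l i y \<le> s i) \<and> weight_ratio (l i) = c i / s i"
    by metis
  \<comment> \<open>Indices outside \<open>{1..n}\<close> get weight 1, which affects neither side of the claim.\<close>
  define l' c' s' where "l' = (\<lambda>i. if i \<in> {1..n} then l i else (\<lambda>_. 1))"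
    and "c' = (\<lambda>i. if i \<in> {1..n} then c i else 1)" and "s' = (\<lambda>i. if i \<in> {1..n} then s i else 1)"
  have l'_eq: "l' i = l i" "weight_ratio (l i) = c' i / s' i" if "i \<in> {1..n}" for i
    using that cs by (simp_all add: l'_def c'_def s'_def)
  have prod_eq: "(\<Prod>i\<in>{1..n}. l' i (x i)) = (\<Prod>i\<in>{1..n}. l i (x i))" for x
    using l'_eq by simp
  have "weighted_exchangeable n l' P"
    using assms(3) unfolding weighted_exchangeable_def prod_eq .
  moreover have "bounded_weights l' c' s'"
    using assms(2) cs by unfold_locales (auto simp: l'_def c'_def s'_def weights_def)
  ultimately interpret weighted_exchangeable_law l' c' s' P n k
    using assms(4,5) by (intro weighted_exchangeable_law.intro weighted_exchangeable_law_axioms.intro)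
  let ?r = "MIN i\<in>{1..k}. weight_ratio (l i)"
  have "0 < ?r"
    using assms(4,5,6) by (subst Min_gr_iff) auto
  moreover have "?r \<le> c' i / s' i" if "i \<in> {1..k}" for i
  proof -
    have "?r \<le> weight_ratio (l i)"
      using that by (intro Min_le) auto
    then show ?thesis
      using that assms(5) l'_eq(2)[of i] by simp
  qed
  ultimately obtain Q where Q: "weighted_iid_mixture n l' Q"
    and close: "\<And>B. B \<in> sets (seq_space k) \<Longrightarrow> \<bar>measure (marginal k P) B - measure (marginal k Q) B\<bar>
      \<le> real k * (real k - 1) / (2 * ?r) *
        (if (\<Sum>i\<in>{k+1..n}. c' i / s' i) = 0 then 1
         else (1 - exp (- (\<Sum>i\<in>{k+1..n}. c' i / s' i))) / (\<Sum>i\<in>{k+1..n}. c' i / s' i))"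
    using pool_mixture_close by blast
  have PiM_eq: "Pi\<^sub>M {1..n} (\<lambda>i. tilt (l' i) \<mu>) = Pi\<^sub>M {1..n} (\<lambda>i. tilt (l i) \<mu>)" for \<mu> :: "'a measure"
    by (intro PiM_cong) (simp_all add: l'_eq)
  have "weighted_iid_mixture n l Q"
    using Q unfolding weighted_iid_mixture_def PiM_eq .
  moreover have sum_eq: "(\<Sum>i\<in>{k+1..n}. c' i / s' i) = (\<Sum>i\<in>{k+1..n}. weight_ratio (l i))"
    using l'_eq(2) by simp
  have "(\<Sum>i\<in>{k+1..n}. weight_ratio (l i)) = 0 \<longleftrightarrow> k = n"
  proof
    assume "k = n" then show "(\<Sum>i\<in>{k+1..n}. weight_ratio (l i)) = 0" by simp
  next
    assume *: "(\<Sum>i\<in>{k+1..n}. weight_ratio (l i)) = 0"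
    show "k = n"
    proof (rule ccontr)
      assume "k \<noteq> n"
      then have "0 < (\<Sum>i\<in>{k+1..n}. weight_ratio (l i))"
        using assms(5,6) by (intro sum_pos) auto
      with * show False by simp
    qed
  qed
  then have "tv_dist (marginal k P) (marginal k Q)
      \<le> real k * (real k - 1) / (2 * ?r) *
         (if k = n then 1
          else (1 - exp (- (\<Sum>i\<in>{k+1..n}. weight_ratio (l i)))) /
               (\<Sum>i\<in>{k+1..n}. weight_ratio (l i)))"
    unfolding tv_dist_def using close unfolding sum_eq
    by (intro cSUP_least) (auto simp: marginal_def intro: sets.empty_sets)
  ultimately show ?thesis by blast
qed

end
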